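(* Let $A\in\mathbb{H}^{n\times n}$. Then, for each right eigenvalue $q\in\mathbb{H}$ of $A$, $$a.m.(q,A)=q.a.m.(q,A)\quad\text{and}\quad g.m.(q,A)=q.g.m.(q,A).$$
   Context: $\mathbb{H}$ is the algebra of real quaternions with units $i,j,k$, and $\mathbb{C}=\{a+bi: a,b\in\mathbb{R}\}\subset\mathbb{H}$. Two quaternions $q_1,q_2$ are similar if $q_1=h^{-1}q_2h$ for some nonzero $h\in\mathbb{H}$; $[q]$ denotes the similarity class of $q$. It is known that each class $[q]$ contains a unique complex number $\lambda_q$ with $\mathrm{Im}(\lambda_q)\ge0$. $\mathbb{H}^n$ is the space of column vectors of length $n$ with entries in $\mathbb{H}$, regarded as a right $\mathbb{H}$-vector space. A quaternion $q$ is a right eigenvalue of $A\in\mathbb{H}^{n\times n}$ if there is a nonzero $x\in\mathbb{H}^n$ with $Ax=xq$; an eigenvector of $A$ is a nonzero $x$ with $Ax=x\alpha$ for some $\alpha\in\mathbb{H}$. $A^*$ is the conjugate transpose; $U$ is unitary if $U^*U=UU^*=Id$. Algebraic multiplicity $a.m.$: it is known that there are $U,T\in\mathbb{H}^{n\times n}$ with $U$ unitary, $T$ upper triangular, $T=U^*AU$, and all diagonal entries of $T$ complex numbers with nonnegative imaginary part. For a right eigenvalue $q$ of $A$, $a.m.(q,A)$ is the number of occurrences of $\lambda_q$ on the diagonal of such a $T$ (this number does not depend on the choice of $U,T$). Geometric multiplicity $g.m.$: for $\tilde q\in\mathbb{H}$ put $V_{\tilde q}=\{x\in\mathbb{H}^n: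 Ax=x\tilde q\}$. The $[q]$-eigenspace is $V_{[q]}:=\sum_{\tilde q\in[q]}V_{\tilde q}$, the set of all finite sums of vectors each lying in some $V_{\tilde q}$ with $\tilde q\in[q]$; it is a right $\mathbb{H}$-vector subspace of $\mathbb{H}^n$. Then $g.m.(q,A):=\dim_{\mathbb{H}}V_{[q]}$, the dimension as a right $\mathbb{H}$-vector space. Classical multiplicities $q.a.m.$ and $q.g.m.$: the minimal polynomial $p^A(t)\in\mathbb{R}[t]$ of $A$ is the monic real polynomial of minimal degree with $p^A(A)=0$. Factor $p^A(t)=p_1(t)^{m_1}\cdots p_k(t)^{m_k}$ with $p_1,\dots,p_k$ distinct monic irreducible real polynomials. For each right eigenvalue $q$ of $A$ there is exactly one index $j$ with $p_j(q)=0$; the root subspace of $q$ is $\mathcal{M}_j:=\{u\in\mathbb{H}^n: p_j(A)^{m_j}u=0\}$ for that $j$. The quaternion geometric multiplicity $q.g.m.(q,A)$ is the maximal number of (right) $\mathbb{H}$-linearly independent eigenvectors of $A$ lying in $\mathcal{M}_j$. The quaternion algebraic multiplicity $q.a.m.(q,A)$ is $\dim_{\mathbb{H}}\mathcal{M}_j$. *)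

theory Defs
  imports "HOL-Analysis.Analysis" "HOL-Computational_Algebra.Polynomial"
begin

section \<open>Quaternions\<close>

codatatype quat = Quat (QRe: real) (QIm1: real) (QIm2: real) (QIm3: real)

lemma quat_eq_iff:
  "x = y \<longleftrightarrow> QRe x = QRe y \<and> QIm1 x = QIm1 y \<and> QIm2 x = QIm2 y \<and> QIm3 x = QIm3 y"
  by (auto intro: quat.expand)

instantiation quat :: ab_group_add
begin

primcorec zero_quat where
  "QRe 0 = 0" | "QIm1 0 = 0" | "QIm2 0 = 0" | "QIm3 0 = 0"

primcorec plus_quat where
  "QRe (x + y) = QRe x + QRe y"
| "QIm1 (x + y) = QIm1 x + QIm1 y"
| "QIm2 (x + y) = QIm2 x + QIm2 y"
| "QIm3 (x + y) = QIm3 x + QIm3 y"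

primcorec uminus_quat where
  "QRe (- x) = - QRe x"
| "QIm1 (- x) = - QIm1 x"
| "QIm2 (- x) = - QIm2 x"
| "QIm3 (- x) = - QIm3 x"

primcorec minus_quat where
  "QRe (x - y) = QRe x - QRe y"
| "QIm1 (x - y) = QIm1 x - QIm1 y"
| "QIm2 (x - y) = QIm2 x - QIm2 y"
| "QIm3 (x - y) = QIm3 x - QIm3 y"

instance
  by standard (simp_all add: quat_eq_iff)

end

instantiation quat :: ring_1
begin

primcorec one_quat where
  "QRe 1 = 1" | "QIm1 1 = 0" | "QIm2 1 = 0" | "QIm3 1 = 0"

primcorec times_quat where
  "QRe (x * y) = QRe x * QRe y - QIm1 x * QIm1 y - QIm2 x * QIm2 y - QIm3 x * QIm3 y"
| "QIm1 (x * y) = QRe x * QIm1 y + QIm1 x * QRe y + QIm2 x * QIm3 y - QIm3 x * QIm2 y"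
| "QIm2 (x * y) = QRe x * QIm2 y - QIm1 x * QIm3 y + QIm2 x * QRe y + QIm3 x * QIm1 y"
| "QIm3 (x * y) = QRe x * QIm3 y + QIm1 x * QIm2 y - QIm2 x * QIm1 y + QIm3 x * QRe y"

instance
  by standard (simp_all add: quat_eq_iff algebra_simps)

end

instantiation quat :: real_algebra_1
begin

primcorec scaleR_quat where
  "QRe (scaleR r x) = r * QRe x"
| "QIm1 (scaleR r x) = r * QIm1 x"
| "QIm2 (scaleR r x) = r * QIm2 x"
| "QIm3 (scaleR r x) = r * QIm3 x"

instance
  by standard (simp_all add: quat_eq_iff algebra_simps)

end

primcorec qcnj :: "quat \<Rightarrow> quat" where
  "QRe (qcnj x) = QRe x"
| "QIm1 (qcnj x) = - QIm1 x"
| "QIm2 (qcnj x) = - QIm2 x"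
| "QIm3 (qcnj x) = - QIm3 x"

definition qnorm2 :: "quat \<Rightarrow> real" where
  "qnorm2 x = (QRe x)\<^sup>2 + (QIm1 x)\<^sup>2 + (QIm2 x)\<^sup>2 + (QIm3 x)\<^sup>2"

lemma qnorm2_eq_0_iff: "qnorm2 x = 0 \<longleftrightarrow> x = 0"
  by (auto simp: qnorm2_def quat_eq_iff add_nonneg_eq_0_iff)

lemma mult_qcnj: "x * qcnj x = qnorm2 x *\<^sub>R 1" and qcnj_mult: "qcnj x * x = qnorm2 x *\<^sub>R 1"
  by (simp_all add: quat_eq_iff qnorm2_def power2_eq_square algebra_simps)

instantiation quat :: inverse
begin

definition inverse_quat :: "quat \<Rightarrow> quat" where
  "inverse x = inverse (qnorm2 x) *\<^sub>R qcnj x"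

definition divide_quat :: "quat \<Rightarrow> quat \<Rightarrow> quat" where
  "x div y = x * inverse y" for x y :: quat

instance ..

end

instance quat :: real_div_algebra
proof
  fix x y :: quat
  show "inverse x * x = 1" "x * inverse x = 1" if "x \<noteq> 0"
    using that by (simp_all add: inverse_quat_def mult_qcnj qcnj_mult qnorm2_eq_0_iff)
  show "x / y = x * inverse y"
    by (rule divide_quat_def)
  show "inverse (0 :: quat) = 0"
    by (simp add: inverse_quat_def quat_eq_iff)
qed

definition quat_i :: quat where "quat_i = Quat 0 1 0 0"
definition quat_j :: quat where "quat_j = Quat 0 0 1 0"
definition quat_k :: quat where "quat_k = Quat 0 0 0 1"

lemma quat_units:
  "quat_i * quat_i = -1" "quat_j * quat_j = -1" "quat_k * quat_k = -1"
  "quat_i * quat_j = quat_k" "quat_j * quat_k = quat_i" "quat_k * quat_i = quat_j"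
  "quat_j * quat_i = - quat_k" "quat_k * quat_j = - quat_i" "quat_i * quat_k = - quat_j"
  by (simp_all add: quat_eq_iff quat_i_def quat_j_def quat_k_def)

text \<open>The embedding of \<open>\<complex> = {a + b i}\<close> into the quaternions.\<close>

definition quat_of_complex :: "complex \<Rightarrow> quat" where
  "quat_of_complex z = of_real (Re z) + of_real (Im z) * quat_i"

definition qsimilar :: "quat \<Rightarrow> quat \<Rightarrow> bool" where
  "qsimilar q1 q2 \<longleftrightarrow> (\<exists>h. h \<noteq> 0 \<and> q1 = inverse h * q2 * h)"

definition sim_class :: "quat \<Rightarrow> quat set" where
  "sim_class q = {p. qsimilar p q}"

text \<open>The representative \<open>\<lambda>\<^sub>q\<close> of the similarity class of \<open>q\<close>.\<close>

definition std_rep :: "quat \<Rightarrow> complex" where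
  "std_rep q = (THE z. quat_of_complex z \<in> sim_class q \<and> Im z \<ge> 0)"


section \<open>The right vector space of quaternionic column vectors\<close>

text \<open>
  The \<open>module\<close> and \<open>vector_space\<close> locales require commutative scalars, and \<open>(*s)\<close> on vectors
  multiplies from the left; hence linear algebra over right scalars is set up here.
\<close>

definition rscale :: "quat ^ 'n \<Rightarrow> quat \<Rightarrow> quat ^ 'n"  (infixl "*\<^sub>H" 75) where
  "x *\<^sub>H c = (\<chi> i. x $ i * c)"

definition rspan :: "(quat ^ 'n) set \<Rightarrow> (quat ^ 'n) set" where
  "rspan S = {\<Sum>v\<in>B. v *\<^sub>H c v | B c. finite B \<and> B \<subseteq> S}"

definition rindependent :: "(quat ^ 'n) set \<Rightarrow> bool" where
  "rindependent S \<longleftrightarrow>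
     (\<forall>B c. finite B \<and> B \<subseteq> S \<and> (\<Sum>v\<in>B. v *\<^sub>H c v) = 0 \<longrightarrow> (\<forall>v\<in>B. c v = 0))"

text \<open>Meaningful only when \<open>V\<close> is a right subspace (otherwise no \<open>B\<close> has span \<open>V\<close>).\<close>

definition rdim :: "(quat ^ 'n) set \<Rightarrow> nat" where
  "rdim V = (THE d. \<exists>B. finite B \<and> rindependent B \<and> rspan B = V \<and> card B = d)"


section \<open>Quaternionic matrices\<close>

type_synonym 'n qmat = "((quat, 'n) vec, 'n) vec"

definition right_eigenvalue :: "quat ^ 'n ^ 'n \<Rightarrow> quat \<Rightarrow> bool" where
  "right_eigenvalue A q \<longleftrightarrow> (\<exists>x. x \<noteq> 0 \<and> A *v x = x *\<^sub>H q)"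

definition right_eigenvector :: "quat ^ 'n ^ 'n \<Rightarrow> quat ^ 'n \<Rightarrow> bool" where
  "right_eigenvector A x \<longleftrightarrow> x \<noteq> 0 \<and> (\<exists>\<alpha>. A *v x = x *\<^sub>H \<alpha>)"

definition adjoint_mat :: "quat ^ 'n ^ 'm \<Rightarrow> quat ^ 'm ^ 'n" where
  "adjoint_mat A = (\<chi> i j. qcnj (A $ j $ i))"

definition unitary :: "quat ^ 'n ^ 'n \<Rightarrow> bool" where
  "unitary U \<longleftrightarrow> adjoint_mat U ** U = mat 1 \<and> U ** adjoint_mat U = mat 1"

text \<open>The linear order of the finite index type plays the role of the order of \<open>1, \<dots>, n\<close>.\<close>

definition upper_triangular :: "'n::{finite, linorder} qmat \<Rightarrow> bool" where
  "upper_triangular T \<longleftrightarrow> (\<forall>i j. j < i \<longrightarrow> T $ i $ j = 0)"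


section \<open>Multiplicities via triangularization and eigenspaces\<close>

definition schur_form ::
    "'n::{finite, linorder} qmat \<Rightarrow> 'n qmat \<Rightarrow> 'n qmat \<Rightarrow> bool" where
  "schur_form A U T \<longleftrightarrow> unitary U \<and> upper_triangular T \<and> T = adjoint_mat U ** A ** U \<and>
     (\<forall>i. \<exists>z. T $ i $ i = quat_of_complex z \<and> Im z \<ge> 0)"

definition alg_mult :: "quat \<Rightarrow> 'n::{finite, linorder} qmat \<Rightarrow> nat" where
  "alg_mult q A =
     (THE m. \<exists>U T. schur_form A U T \<and> m = card {i. T $ i $ i = quat_of_complex (std_rep q)})"

definition eigvecs0 :: "quat \<Rightarrow> quat ^ 'n ^ 'n \<Rightarrow> (quat ^ 'n) set" where
  "eigvecs0 q A = {x. A *v x = x *\<^sub>H q}"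

definition class_eigenspace :: "quat \<Rightarrow> quat ^ 'n ^ 'n \<Rightarrow> (quat ^ 'n) set" where
  "class_eigenspace q A = {sum_list xs | xs. \<forall>x\<in>set xs. \<exists>p\<in>sim_class q. x \<in> eigvecs0 p A}"

definition geom_mult :: "quat \<Rightarrow> quat ^ 'n ^ 'n \<Rightarrow> nat" where
  "geom_mult q A = rdim (class_eigenspace q A)"


section \<open>Classical multiplicities via the real minimal polynomial\<close>

text \<open>
  \<open>(*)\<close> and \<open>(^)\<close> on the type of matrices act entrywise, and \<open>poly\<close> needs a commutative ring,
  so powers of matrices and evaluation of real polynomials are defined explicitly.
\<close>

primrec mat_pow :: "quat ^ 'n ^ 'n \<Rightarrow> nat \<Rightarrow> quat ^ 'n ^ 'n" where
  "mat_pow A 0 = mat 1"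
| "mat_pow A (Suc k) = A ** mat_pow A k"

definition rpoly_mat :: "real poly \<Rightarrow> quat ^ 'n ^ 'n \<Rightarrow> quat ^ 'n ^ 'n" where
  "rpoly_mat p A = (\<Sum>i\<le>degree p. coeff p i *\<^sub>R mat_pow A i)"

definition rpoly_quat :: "real poly \<Rightarrow> quat \<Rightarrow> quat" where
  "rpoly_quat p q = (\<Sum>i\<le>degree p. coeff p i *\<^sub>R q ^ i)"

definition is_min_poly :: "quat ^ 'n ^ 'n \<Rightarrow> real poly \<Rightarrow> bool" where
  "is_min_poly A p \<longleftrightarrow> lead_coeff p = 1 \<and> rpoly_mat p A = 0 \<and>
     (\<forall>r. lead_coeff r = 1 \<and> rpoly_mat r A = 0 \<longrightarrow> degree p \<le> degree r)"

definition min_poly :: "quat ^ 'n ^ 'n \<Rightarrow> real poly" where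
  "min_poly A = (THE p. is_min_poly A p)"

text \<open>\<open>P\<close> is the set \<open>{p\<^sub>1, \<dots>, p\<^sub>k}\<close> of distinct factors and \<open>m\<close> assigns the exponent to each.\<close>

definition monic_factorization :: "real poly \<Rightarrow> real poly set \<Rightarrow> (real poly \<Rightarrow> nat) \<Rightarrow> bool" where
  "monic_factorization p P m \<longleftrightarrow> finite P \<and>
     (\<forall>r\<in>P. lead_coeff r = 1 \<and> irreducible r \<and> m r \<ge> 1) \<and> p = (\<Prod>r\<in>P. r ^ m r)"

definition root_subspace :: "quat \<Rightarrow> quat ^ 'n ^ 'n \<Rightarrow> (quat ^ 'n) set" where
  "root_subspace q A = (THE M. \<exists>P m r. monic_factorization (min_poly A) P m \<and> r \<in> P \<and>
     rpoly_quat r q = 0 \<and> M = {u. mat_pow (rpoly_mat r A) (m r) *v u = 0})"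

definition q_alg_mult :: "quat \<Rightarrow> quat ^ 'n ^ 'n \<Rightarrow> nat" where
  "q_alg_mult q A = rdim (root_subspace q A)"

definition q_geom_mult :: "quat \<Rightarrow> quat ^ 'n ^ 'n \<Rightarrow> nat" where
  "q_geom_mult q A =
     Max {card B | B. finite B \<and> B \<subseteq> root_subspace q A \<and> (\<forall>x\<in>B. right_eigenvector A x) \<and>
                      rindependent B}"

end

theory Submission
  imports Defs "HOL-Computational_Algebra.Polynomial_Factorial"
    "HOL-Computational_Algebra.Field_as_Ring"
    "HOL-Computational_Algebra.Fundamental_Theorem_Algebra"
begin

text \<open>
  Let \<open>r\<close> be the irreducible real factor of the minimal polynomial with root \<open>q\<close>; its quaternionic roots are
  exactly the elements of the class of \<open>q\<close>. The root subspace is the stable kernel of \<open>r(A)\<close>, that is,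
  the kernel of \<open>r(A)\<^sup>k\<close> for all large \<open>k\<close>. In a Schur basis \<open>r(A)\<close> becomes the upper triangular
  matrix \<open>r(T)\<close>, and the dimension of the stable kernel of a triangular matrix is the number of zeros on
  its diagonal. These are the positions where \<open>r\<close> vanishes at the diagonal entry of \<open>T\<close>, i.e. where
  this entry is \<open>\<lambda>\<^sub>q\<close>.

  An eigenvector \<open>x\<close> with \<open>A x = x p\<close> satisfies \<open>r(A)\<^sup>k x = x r(p)\<^sup>k\<close>, so it lies in the root subspace
  exactly if \<open>p\<close> is similar to \<open>q\<close>. Hence the eigenvectors in the root subspace span the
  \<open>[q]\<close>-eigenspace.

  A right subspace of quaternionic dimension \<open>d\<close> has real dimension \<open>4 d\<close>, so all dimension counts
  are carried out over the reals.
\<close>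

section \<open>Quaternions as a Euclidean space\<close>

instantiation quat :: real_normed_vector
begin

definition norm_quat_def: "norm x = sqrt (qnorm2 x)"
definition sgn_quat_def: "sgn x = x /\<^sub>R norm x" for x :: quat
definition dist_quat_def: "dist x y = norm (x - y)" for x y :: quat
definition uniformity_quat_def:
  "(uniformity :: (quat \<times> quat) filter) = (INF e\<in>{0 <..}. principal {(x, y :: quat). dist x y < e})"
definition open_quat_def:
  "open (U :: quat set) \<longleftrightarrow> (\<forall>x\<in>U. eventually (\<lambda>(x', y). x' = x \<longrightarrow> y \<in> U) uniformity)"

text \<open>A real-linear isometry into a normed product space, along which the triangle inequality
  and the homogeneity of the norm are pulled back.\<close>

definition quat_tuple :: "quat \<Rightarrow> complex \<times> complex" where
  "quat_tuple x = (Complex (QRe x) (QIm1 x), Complex (QIm2 x) (QIm3 x))"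

lemma norm_quat_tuple: "norm x = norm (quat_tuple x)"
  by (simp add: norm_quat_def qnorm2_def quat_tuple_def norm_prod_def cmod_def add.assoc)

instance
proof
  fix r :: real and x y :: quat
  show "(norm x = 0) = (x = 0)"
    by (simp add: norm_quat_def qnorm2_eq_0_iff)
  have "quat_tuple (x + y) = quat_tuple x + quat_tuple y"
    by (simp add: quat_tuple_def complex_eq_iff)
  then show "norm (x + y) \<le> norm x + norm y"
    unfolding norm_quat_tuple by (metis norm_triangle_ineq)
  have "quat_tuple (r *\<^sub>R x) = r *\<^sub>R quat_tuple x"
    by (simp add: quat_tuple_def complex_eq_iff)
  then show "norm (r *\<^sub>R x) = \<bar>r\<bar> * norm x"
    unfolding norm_quat_tuple by (metis norm_scaleR)
qed (rule sgn_quat_def dist_quat_def open_quat_def uniformity_quat_def)+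

end

instantiation quat :: real_inner
begin

definition inner_quat :: "quat \<Rightarrow> quat \<Rightarrow> real" where
  "inner x y = QRe x * QRe y + QIm1 x * QIm1 y + QIm2 x * QIm2 y + QIm3 x * QIm3 y"

instance
proof
  fix r :: real and x y z :: quat
  have self: "inner x x = qnorm2 x"
    by (simp add: inner_quat_def qnorm2_def power2_eq_square)
  show "0 \<le> inner x x" "(inner x x = 0) = (x = 0)" "norm x = sqrt (inner x x)"
    unfolding self by (simp_all add: qnorm2_eq_0_iff norm_quat_def) (simp add: qnorm2_def)
qed (simp_all add: inner_quat_def algebra_simps)

end

instantiation quat :: euclidean_space
begin

definition Basis_quat :: "quat set" where "Basis = {1, quat_i, quat_j, quat_k}"

instance
proof
  fix u v x :: quat
  show "(Basis :: quat set) \<noteq> {}" "finite (Basis :: quat set)"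
    by (simp_all add: Basis_quat_def)
  show "inner u v = (if u = v then 1 else 0)" if "u \<in> Basis" "v \<in> Basis"
  proof -
    have "1 \<noteq> quat_i" "1 \<noteq> quat_j" "1 \<noteq> quat_k" "quat_i \<noteq> quat_j" "quat_i \<noteq> quat_k" "quat_j \<noteq> quat_k"
      unfolding quat_eq_iff by (simp_all add: quat_i_def quat_j_def quat_k_def)
    moreover have "inner 1 quat_i = 0" "inner 1 quat_j = 0" "inner 1 quat_k = 0"
      "inner quat_i quat_j = 0" "inner quat_i quat_k = 0" "inner quat_j quat_k = 0"
      "inner quat_i 1 = 0" "inner quat_j 1 = 0" "inner quat_k 1 = 0"
      "inner quat_j quat_i = 0" "inner quat_k quat_i = 0" "inner quat_k quat_j = 0"
      "inner (1 :: quat) 1 = 1" "inner quat_i quat_i = 1" "inner quat_j quat_j = 1"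
      "inner quat_k quat_k = 1"
      by (simp_all add: inner_quat_def quat_i_def quat_j_def quat_k_def)
    ultimately show ?thesis
      using that unfolding Basis_quat_def by fastforce
  qed
  show "(\<forall>u\<in>Basis. inner x u = 0) \<longleftrightarrow> x = 0"
    by (simp add: Basis_quat_def inner_quat_def quat_i_def quat_j_def quat_k_def quat_eq_iff[of x])
qed

end

lemma DIM_quat [simp]: "DIM(quat) = 4"
  by (simp add: Basis_quat_def quat_i_def quat_j_def quat_k_def quat_eq_iff)


section \<open>Right subspaces\<close>

lemma rscale_nth [simp]: "(x *\<^sub>H c) $ i = x $ i * c"
  by (simp add: rscale_def)

lemma rscale_simps [simp]:
  "x *\<^sub>H 0 = 0" "x *\<^sub>H 1 = x" "0 *\<^sub>H c = 0" "(- x) *\<^sub>H c = - (x *\<^sub>H c)" "x *\<^sub>H (- c) = - (x *\<^sub>H c)"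
  "(r *\<^sub>R x) *\<^sub>H c = r *\<^sub>R (x *\<^sub>H c)" "x *\<^sub>H (r *\<^sub>R c) = r *\<^sub>R (x *\<^sub>H c)"
  "x *\<^sub>H c *\<^sub>H d = x *\<^sub>H (c * d)"
  by (simp_all add: vec_eq_iff mult.assoc)

lemma rscale_distribs:
  "(x + y) *\<^sub>H c = x *\<^sub>H c + y *\<^sub>H c" "x *\<^sub>H (c + d) = x *\<^sub>H c + x *\<^sub>H d"
  "(x - y) *\<^sub>H c = x *\<^sub>H c - y *\<^sub>H c" "x *\<^sub>H (c - d) = x *\<^sub>H c - x *\<^sub>H d"
  by (simp_all add: vec_eq_iff algebra_simps)

lemma rscale_sum_left: "(\<Sum>i\<in>I. f i) *\<^sub>H c = (\<Sum>i\<in>I. f i *\<^sub>H c)"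
  by (induction I rule: infinite_finite_induct) (simp_all add: rscale_distribs)

lemma rscale_eq_0_iff: "x *\<^sub>H c = 0 \<longleftrightarrow> x = 0 \<or> c = 0"
  by (auto simp: vec_eq_iff)

lemma linear_rscale: "linear ((*\<^sub>H) x)"
  by (rule linearI) (simp_all add: rscale_distribs)

text \<open>Built on the real \<open>subspace\<close>, so that the real dimension \<open>dim\<close>
  and its theory apply directly.\<close>

definition rsubspace :: "(quat ^ 'n) set \<Rightarrow> bool" where
  "rsubspace V \<longleftrightarrow> subspace V \<and> (\<forall>x\<in>V. \<forall>c. x *\<^sub>H c \<in> V)"

lemma rsubspaceD:
  assumes "rsubspace V"
  shows "subspace V" "0 \<in> V" "x \<in> V \<Longrightarrow> y \<in> V \<Longrightarrow> x + y \<in> V" "x \<in> V \<Longrightarrow> y \<in> V \<Longrightarrow> x - y \<in> V"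
    "x \<in> V \<Longrightarrow> x *\<^sub>H c \<in> V" "x \<in> V \<Longrightarrow> - x \<in> V"
  using assms by (auto simp: rsubspace_def subspace_0 subspace_add subspace_diff subspace_neg)

lemma rsubspace_sum:
  "rsubspace V \<Longrightarrow> (\<And>i. i \<in> I \<Longrightarrow> f i \<in> V) \<Longrightarrow> (\<Sum>i\<in>I. f i) \<in> V"
  by (simp add: rsubspace_def subspace_sum)

text \<open>Scaling by a real r is right multiplication by the real quaternion
  \<open>r *\<^sub>R 1\<close>.\<close>

lemma rsubspaceI:
  assumes "0 \<in> V" "\<And>x y. x \<in> V \<Longrightarrow> y \<in> V \<Longrightarrow> x + y \<in> V" "\<And>x c. x \<in> V \<Longrightarrow> x *\<^sub>H c \<in> V"
  shows "rsubspace V"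
proof -
  have "r *\<^sub>R x \<in> V" if "x \<in> V" for r x
    using assms(3)[OF that, of "r *\<^sub>R 1"] by simp
  with assms show ?thesis
    by (simp add: rsubspace_def subspace_def)
qed

lemma rspanI: "finite B \<Longrightarrow> B \<subseteq> S \<Longrightarrow> (\<Sum>v\<in>B. v *\<^sub>H c v) \<in> rspan S"
  unfolding rspan_def by blast

lemma rspan_base: "v \<in> S \<Longrightarrow> v \<in> rspan S"
  using rspanI[of "{v}" S "\<lambda>_. 1"] by simp

lemma rspan_minimal: "rsubspace V \<Longrightarrow> S \<subseteq> V \<Longrightarrow> rspan S \<subseteq> V"
  unfolding rspan_def by (force intro!: rsubspace_sum intro: rsubspaceD)

lemma rsubspace_rspan: "rsubspace (rspan S)"
proof (rule rsubspaceI)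
  show "0 \<in> rspan S"
    using rspanI[of "{}" S] by simp
next
  fix x y assume "x \<in> rspan S" "y \<in> rspan S"
  then obtain B c C d where B: "finite B" "B \<subseteq> S" "x = (\<Sum>v\<in>B. v *\<^sub>H c v)"
    and C: "finite C" "C \<subseteq> S" "y = (\<Sum>v\<in>C. v *\<^sub>H d v)"
    unfolding rspan_def by blast
  \<comment> \<open>Zero coefficients extend both combinations to a common index set, over which
    they can be added.\<close>
  have "x = (\<Sum>v\<in>B \<union> C. v *\<^sub>H (if v \<in> B then c v else 0))"
    using B C by (auto intro!: sum.mono_neutral_cong_left)
  moreover have "y = (\<Sum>v\<in>B \<union> C. v *\<^sub>H (if v \<in> C then d v else 0))"
    using B C by (auto intro!: sum.mono_neutral_cong_left)
  ultimately have "x + y =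
      (\<Sum>v\<in>B \<union> C. v *\<^sub>H ((if v \<in> B then c v else 0) + (if v \<in> C then d v else 0)))"
    by (simp only: rscale_distribs sum.distrib)
  then show "x + y \<in> rspan S"
    using rspanI[of "B \<union> C" S
        "\<lambda>v. (if v \<in> B then c v else 0) + (if v \<in> C then d v else 0)"] B(1,2) C(1,2)
    by (simp only: finite_Un Un_subset_iff simp_thms)
next
  fix x c assume "x \<in> rspan S"
  then obtain B d where B: "finite B" "B \<subseteq> S" "x = (\<Sum>v\<in>B. v *\<^sub>H d v)"
    unfolding rspan_def by blast
  then show "x *\<^sub>H c \<in> rspan S"
    using rspanI[of B S "\<lambda>v. d v * c"] by (simp add: rscale_sum_left)
qed

lemma rspan_mono: "S \<subseteq> T \<Longrightarrow> rspan S \<subseteq> rspan T"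
  by (rule rspan_minimal[OF rsubspace_rspan]) (auto intro: rspan_base)

section \<open>Adjoining one vector to a right subspace\<close>

definition radjoin :: "quat ^ 'n \<Rightarrow> (quat ^ 'n) set \<Rightarrow> (quat ^ 'n) set" where
  "radjoin b V = {x + y | x y. x \<in> V \<and> y \<in> range ((*\<^sub>H) b)}"

lemma radjoinI: "x \<in> V \<Longrightarrow> x + b *\<^sub>H c \<in> radjoin b V"
  by (auto simp: radjoin_def)

lemma radjoinE:
  assumes "z \<in> radjoin b V" obtains x c where "x \<in> V" "z = x + b *\<^sub>H c"
  using assms by (auto simp: radjoin_def)

lemma rsubspace_radjoin:
  assumes "rsubspace V" shows "rsubspace (radjoin b V)"
proof (rule rsubspaceI)
  show "0 \<in> radjoin b V"
    using radjoinI[of 0 V b 0] assms by (simp add: rsubspaceD)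
next
  fix x y assume "x \<in> radjoin b V" "y \<in> radjoin b V"
  then obtain u v c d where "u \<in> V" "v \<in> V" "x = u + b *\<^sub>H c" "y = v + b *\<^sub>H d"
    by (elim radjoinE) blast
  then show "x + y \<in> radjoin b V"
    using radjoinI[of "u + v" V b "c + d"] rsubspaceD(3)[OF assms]
    by (simp add: rscale_distribs algebra_simps)
next
  fix x c assume "x \<in> radjoin b V"
  then show "x *\<^sub>H c \<in> radjoin b V"
    using assms by (auto elim!: radjoinE intro!: radjoinI simp: rscale_distribs rsubspaceD)
qed

text \<open>For b nonzero, c \<mapsto> b c is real-linear and injective, so the line b H has real
  dimension 4. It meets V only in 0: if b c is in V with c nonzero, right multiplication by the
  inverse of c brings b into V.\<close>

lemma dim_radjoin:
  assumes "rsubspace V" "b \<notin> V"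
  shows "dim (radjoin b V) = dim V + 4"
proof -
  have "b \<noteq> 0"
    using assms rsubspaceD(2) by blast
  then have "inj ((*\<^sub>H) b)"
    by (simp add: linear_injective_0[OF linear_rscale] rscale_eq_0_iff)
  then have "dim (range ((*\<^sub>H) b)) = 4"
    by (simp add: dim_image_eq[OF linear_rscale])
  moreover have "V \<inter> range ((*\<^sub>H) b) = {0}"
  proof -
    have "c = 0" if "b *\<^sub>H c \<in> V" for c
      using rsubspaceD(5)[OF assms(1) that, of "inverse c"] assms(2)
      by (cases "c = 0") simp_all
    then show ?thesis
      using rsubspaceD(2)[OF assms(1)] by (force intro: rev_image_eqI[of 0])
  qed
  moreover have "subspace (range ((*\<^sub>H) b))"
    by (rule linear_subspace_image[OF linear_rscale]) simp
  ultimately show ?thesis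
    using dim_sums_Int[of V "range ((*\<^sub>H) b)"] assms by (simp add: radjoin_def rsubspaceD)
qed

lemma rspan_insert: "rspan (insert b S) = radjoin b (rspan S)"
proof
  have "insert b S \<subseteq> radjoin b (rspan S)"
    using radjoinI[of 0 "rspan S" b 1] radjoinI[of _ "rspan S" b 0]
    by (auto simp: rsubspaceD[OF rsubspace_rspan] rspan_base)
  then show "rspan (insert b S) \<subseteq> radjoin b (rspan S)"
    by (intro rspan_minimal rsubspace_radjoin rsubspace_rspan)
  show "radjoin b (rspan S) \<subseteq> rspan (insert b S)"
    using rspan_mono[of S "insert b S"] rspan_base[of b "insert b S"]
    by (auto elim!: radjoinE intro!: rsubspaceD(3,5)[OF rsubspace_rspan])
qed

lemma rspan_empty [simp]: "rspan {} = {0}"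
  by (auto simp: rspan_def)

lemma rindependent_insertD:
  assumes "rindependent (insert b S)" "b \<notin> S"
  shows "rindependent S" "b \<notin> rspan S"
proof -
  show "rindependent S"
    using assms(1) unfolding rindependent_def by blast
  show "b \<notin> rspan S"
  proof
    assume "b \<in> rspan S"
    then obtain B c where B: "finite B" "B \<subseteq> S" "b = (\<Sum>v\<in>B. v *\<^sub>H c v)"
      unfolding rspan_def by blast
    \<comment> \<open>Coefficient -1 at b turns the representation of b over B into a nontrivial
      relation.\<close>
    define d where "d v = (if v = b then - 1 else c v)" for v
    have "b \<notin> B"
      using assms(2) B by blast
    then have "(\<Sum>v\<in>insert b B. v *\<^sub>H d v) = - b + (\<Sum>v\<in>B. v *\<^sub>H c v)"
      using B(1) by (auto simp: d_def intro!: sum.cong)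
    also have "\<dots> = 0"
      using B(3) by simp
    finally have "\<forall>v\<in>insert b B. d v = 0"
      using assms(1) B unfolding rindependent_def by (meson finite_insert insert_mono)
    then have "d b = 0"
      by blast
    then show False
      by (simp add: d_def)
  qed
qed

text \<open>A relation with a nonzero coefficient at b could be solved for b, putting b into the
  span; any other relation is one inside S.\<close>

lemma rindependent_insertI:
  assumes "rindependent S" "b \<notin> rspan S"
  shows "rindependent (insert b S)"
  unfolding rindependent_def
proof (intro allI impI, elim conjE)
  fix B c assume B: "finite B" "B \<subseteq> insert b S" "(\<Sum>v\<in>B. v *\<^sub>H c v) = 0"
  show "\<forall>v\<in>B. c v = 0"
  proof (cases "b \<in> B \<and> c b \<noteq> 0")
    case True
    define x where "x = (\<Sum>v\<in>B - {b}. v *\<^sub>H c v)"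
    have "b *\<^sub>H c b + x = 0"
      using B(1,3) True by (simp add: x_def sum.remove[of B b])
    then have "b *\<^sub>H c b = - x"
      by (simp add: eq_neg_iff_add_eq_0)
    moreover have "x \<in> rspan S"
      unfolding x_def using B by (intro rspanI) auto
    ultimately have "b *\<^sub>H c b *\<^sub>H inverse (c b) \<in> rspan S"
      by (metis rsubspaceD(5,6) rsubspace_rspan)
    then show ?thesis
      using True assms(2) by simp
  next
    case False
    then have "(\<Sum>v\<in>B - {b}. v *\<^sub>H c v) = 0"
      using B(1,3) by (cases "b \<in> B") (simp_all add: sum.remove[of B b])
    moreover have "finite (B - {b})" "B - {b} \<subseteq> S"
      using B(1,2) by auto
    ultimately have "\<forall>v\<in>B - {b}. c v = 0"
      using assms(1) unfolding rindependent_def by blast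
    then show ?thesis
      using False by blast
  qed
qed

section \<open>Bases and dimension\<close>

lemma dim_rspan:
  assumes "finite B" "rindependent B"
  shows "dim (rspan B) = 4 * card B"
  using assms
proof (induction B rule: finite_induct)
  case (insert b B)
  then show ?case
    using rindependent_insertD[of b B] by (simp add: rspan_insert dim_radjoin rsubspace_rspan)
qed (simp add: dim_eq_0)

lemma card_rindependent_le:
  assumes "finite B" "rindependent B" "B \<subseteq> V" "rsubspace V"
  shows "4 * card B \<le> dim V"
  unfolding dim_rspan[OF assms(1,2), symmetric] by (intro dim_subset rspan_minimal assms)

text \<open>Independent subsets of S have bounded size, so one of largest size exists. By maximality
  no element of S lies outside its span. Choosing the basis inside S matters later, where S consists
  of eigenvectors.\<close>

lemma rspan_basis_exists:
  obtains B where "finite B" "B \<subseteq> S" "rindependent B" "rspan B = rspan S"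
proof -
  define P where "P n \<longleftrightarrow> (\<exists>B. finite B \<and> B \<subseteq> S \<and> rindependent B \<and> card B = n)" for n
  have "P 0"
    unfolding P_def by (rule exI[of _ "{}"]) (simp add: rindependent_def)
  moreover have "n \<le> dim (rspan S)" if "P n" for n
  proof -
    obtain B where "finite B" "B \<subseteq> S" "rindependent B" "card B = n"
      using \<open>P n\<close> unfolding P_def by blast
    then show ?thesis
      using card_rindependent_le[OF _ _ _ rsubspace_rspan, of B S] rspan_base[of _ S]
      by fastforce
  qed
  ultimately obtain n where n: "P n" "\<And>m. P m \<Longrightarrow> m \<le> n"
    using Nat.ex_has_greatest_nat[of P 0] by blast
  then obtain B where B: "finite B" "B \<subseteq> S" "rindependent B" "card B = n"
    unfolding P_def by blast
  have "S \<subseteq> rspan B"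
  proof
    fix b assume b: "b \<in> S"
    show "b \<in> rspan B"
    proof (rule ccontr)
      assume nb: "b \<notin> rspan B"
      then have "b \<notin> B"
        using rspan_base by blast
      then have "P (Suc n)"
        unfolding P_def using B b nb
        by (intro exI[of _ "insert b B"]) (auto intro: rindependent_insertI)
      then show False
        using n(2) by fastforce
    qed
  qed
  then have "rspan B = rspan S"
    using B(2) by (intro equalityI rspan_mono rspan_minimal rsubspace_rspan)
  with B that show ?thesis
    by blast
qed

lemma rspan_rsubspace: "rsubspace V \<Longrightarrow> rspan V = V"
  by (intro equalityI rspan_minimal) (auto intro: rspan_base)

text \<open>Every basis has a quarter of the real dimension as its cardinality; this also makes the
  description in \<open>rdim\<close> well defined.\<close>

lemma rdim_eq:
  assumes "rsubspace V" shows "4 * rdim V = dim V"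
proof -
  obtain B where B: "finite B" "rindependent B" "rspan B = V"
    using rspan_basis_exists[of V] rspan_rsubspace[OF assms] by metis
  have "rdim V = card B"
    unfolding rdim_def
  proof (rule the_equality)
    fix d assume "\<exists>C. finite C \<and> rindependent C \<and> rspan C = V \<and> card C = d"
    then obtain C where "finite C" "rindependent C" "rspan C = V" "card C = d"
      by blast
    then show "d = card B"
      using dim_rspan[of B] dim_rspan[of C] B by simp
  qed (use B in blast)
  then show ?thesis
    using dim_rspan[of B] B by simp
qed


section \<open>Similarity\<close>

lemma qnorm2_mult: "qnorm2 (x * y) = qnorm2 x * qnorm2 y"
  by (simp add: qnorm2_def power2_eq_square algebra_simps)

lemma QRe_mult_commute: "QRe (x * y) = QRe (y * x)"
  by (simp add: algebra_simps)

lemma qsimilarI: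
  assumes "h \<noteq> 0" "h * p = q * h" shows "qsimilar p q"
  unfolding qsimilar_def
proof (intro exI[of _ h] conjI)
  show "p = inverse h * q * h"
    using assms by (simp add: mult.assoc flip: assms(2)) (simp flip: mult.assoc)
qed (fact assms)

lemma qsimilarE:
  assumes "qsimilar p q" obtains h where "h \<noteq> 0" "h * p = q * h"
proof -
  obtain h where h: "h \<noteq> 0" "p = inverse h * q * h"
    using assms unfolding qsimilar_def by blast
  then have "h * p = q * h"
    by (simp flip: mult.assoc)
  with h that show ?thesis
    by blast
qed

lemma qsimilar_iff: "qsimilar p q \<longleftrightarrow> QRe p = QRe q \<and> qnorm2 p = qnorm2 q"
proof (intro iffI conjI, goal_cases)
  case 1
  then obtain h where h: "h \<noteq> 0" "p = inverse h * (q * h)"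
    by (auto simp: qsimilar_def mult.assoc)
  then have "QRe p = QRe (q * h * inverse h)"
    by (simp only: QRe_mult_commute)
  then show ?case
    using h(1) by (simp add: mult.assoc)
next
  case 2
  then obtain h where h: "h \<noteq> 0" "h * p = q * h"
    by (rule qsimilarE)
  then have "qnorm2 h * qnorm2 p = qnorm2 h * qnorm2 q"
    by (metis qnorm2_mult mult.commute)
  then show ?case
    using h(1) by (simp add: qnorm2_eq_0_iff)
next
  case 3
  then have Re: "QRe p = QRe q"
    and Im: "QIm1 p * QIm1 p + QIm2 p * QIm2 p + QIm3 p * QIm3 p =
      QIm1 q * QIm1 q + QIm2 q * QIm2 q + QIm3 q * QIm3 q"
    unfolding qnorm2_def power2_eq_square by auto
  \<comment> \<open>Let u and v be the imaginary parts of p and q. They have equal length, so u u =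
    v v, and therefore (u + v) u = v (u + v).\<close>
  define h where "h = Quat 0 (QIm1 p + QIm1 q) (QIm2 p + QIm2 q) (QIm3 p + QIm3 q)"
  consider "h \<noteq> 0" | "h = 0" "QIm1 p \<noteq> 0 \<or> QIm2 p \<noteq> 0" | "h = 0" "QIm1 p = 0" "QIm2 p = 0"
    by blast
  then show ?case
  proof cases
    case 1
    moreover have "h * p = q * h"
      using Re Im by (simp add: quat_eq_iff h_def algebra_simps)
    ultimately show ?thesis
      by (rule qsimilarI)
  next
    case 2
    \<comment> \<open>here \<open>q\<close> is the conjugate of \<open>p\<close>, so \<open>h\<close> has to anticommute with the imaginary part\<close>
    then have q: "QIm1 q = - QIm1 p" "QIm2 q = - QIm2 p" "QIm3 q = - QIm3 p"
      by (auto simp: h_def quat_eq_iff)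
    have "Quat 0 (- QIm2 p) (QIm1 p) 0 \<noteq> 0"
      using 2 by (auto simp: quat_eq_iff)
    moreover have "Quat 0 (- QIm2 p) (QIm1 p) 0 * p = q * Quat 0 (- QIm2 p) (QIm1 p) 0"
      using Re q by (simp add: quat_eq_iff algebra_simps)
    ultimately show ?thesis
      by (rule qsimilarI)
  next
    case 3
    then have q: "QIm1 q = 0" "QIm2 q = 0" "QIm3 q = - QIm3 p"
      by (auto simp: h_def quat_eq_iff)
    \<comment> \<open>The imaginary parts are now opposite multiples of k, and i anticommutes with
      k.\<close>
    have "quat_i \<noteq> 0"
      by (simp add: quat_eq_iff quat_i_def)
    moreover have "quat_i * p = q * quat_i"
      using Re q 3 by (simp add: quat_eq_iff quat_i_def)
    ultimately show ?thesis
      by (rule qsimilarI)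
  qed
qed

lemma quat_of_complex_sel [simp]:
  "QRe (quat_of_complex z) = Re z" "QIm1 (quat_of_complex z) = Im z"
  "QIm2 (quat_of_complex z) = 0" "QIm3 (quat_of_complex z) = 0"
  by (simp_all add: quat_of_complex_def quat_i_def of_real_def)

text \<open>Equality of real part and norm forces the nonnegative imaginary part to be the length of
  the imaginary part of q. This evaluates the description in \<open>std_rep\<close>.\<close>

lemma quat_of_complex_similar_iff:
  assumes "Im z \<ge> 0"
  shows "qsimilar (quat_of_complex z) q \<longleftrightarrow> quat_of_complex z = quat_of_complex (std_rep q)"
proof -
  have 1: "qsimilar (quat_of_complex w) q \<and> Im w \<ge> 0 \<longleftrightarrow>
      w = Complex (QRe q) (sqrt ((QIm1 q)\<^sup>2 + (QIm2 q)\<^sup>2 + (QIm3 q)\<^sup>2))" for w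
    by (auto simp: qsimilar_iff qnorm2_def complex_eq_iff real_sqrt_unique add.assoc)
  then have "std_rep q = Complex (QRe q) (sqrt ((QIm1 q)\<^sup>2 + (QIm2 q)\<^sup>2 + (QIm3 q)\<^sup>2))"
    by (simp add: std_rep_def sim_class_def)
  moreover have "quat_of_complex z = quat_of_complex w \<longleftrightarrow> z = w" for w
    by (simp add: quat_eq_iff complex_eq_iff)
  ultimately show ?thesis
    using 1[of z] assms by simp
qed


section \<open>Real polynomials in quaternions and quaternionic matrices\<close>

text \<open>Here f stands for the sequence of powers of a quaternion or of a matrix, so that both
  evaluations of real polynomials share these facts.\<close>

context
  fixes f :: "nat \<Rightarrow> 'a::real_vector"
begin

lemma poly_sum_bound:
  assumes "degree p \<le> n"
  shows "(\<Sum>i\<le>degree p. coeff p i *\<^sub>R f i) = (\<Sum>i\<le>n. coeff p i *\<^sub>R f i)"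
  using assms by (intro sum.mono_neutral_left) (auto simp: coeff_eq_0)

lemma poly_sum_add:
  "(\<Sum>i\<le>degree (p + q). coeff (p + q) i *\<^sub>R f i) =
    (\<Sum>i\<le>degree p. coeff p i *\<^sub>R f i) + (\<Sum>i\<le>degree q. coeff q i *\<^sub>R f i)"
proof -
  \<comment> \<open>The degree of p + q may drop by cancellation, so all three sums are padded to a
    common bound.\<close>
  define n where "n = max (degree p) (degree q)"
  have "degree (p + q) \<le> n" "degree p \<le> n" "degree q \<le> n"
    by (auto simp: n_def degree_add_le_max)
  then show ?thesis
    by (simp only: poly_sum_bound[of "p + q" n] poly_sum_bound[of p n] poly_sum_bound[of q n])
      (simp add: scaleR_add_left sum.distrib)
qed

lemma poly_sum_smult:
  "(\<Sum>i\<le>degree (smult a p). coeff (smult a p) i *\<^sub>R f i) = a *\<^sub>R (\<Sum>i\<le>degree p. coeff p i *\<^sub>R f i)"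
  by (subst poly_sum_bound[of "smult a p" "degree p"]) (simp_all add: scaleR_sum_right)

lemma poly_sum_pCons:
  "(\<Sum>i\<le>degree (pCons a p). coeff (pCons a p) i *\<^sub>R f i) =
    a *\<^sub>R f 0 + (\<Sum>i\<le>degree p. coeff p i *\<^sub>R f (Suc i))"
  by (subst poly_sum_bound[of "pCons a p" "Suc (degree p)"])
    (auto simp: sum.atMost_Suc_shift degree_pCons_le simp del: sum.atMost_Suc)

end

lemma rpoly_quat_0 [simp]: "rpoly_quat 0 x = 0"
  by (simp add: rpoly_quat_def)

lemma rpoly_quat_add: "rpoly_quat (p + q) x = rpoly_quat p x + rpoly_quat q x"
  by (simp only: rpoly_quat_def poly_sum_add)

lemma rpoly_quat_smult: "rpoly_quat (smult a p) x = a *\<^sub>R rpoly_quat p x"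
  by (simp only: rpoly_quat_def poly_sum_smult)

lemma rpoly_quat_pCons [simp]: "rpoly_quat (pCons a p) x = a *\<^sub>R 1 + x * rpoly_quat p x"
  by (simp add: rpoly_quat_def poly_sum_pCons sum_distrib_left del: coeff_pCons_Suc degree_pCons_eq_if)

text \<open>Real coefficients are central, so evaluation is multiplicative even though H is not
  commutative.\<close>

lemma rpoly_quat_mult: "rpoly_quat (p * q) x = rpoly_quat p x * rpoly_quat q x"
  by (induction p) (simp_all add: rpoly_quat_add rpoly_quat_smult distrib_right mult.assoc)

lemma rpoly_quat_1 [simp]: "rpoly_quat 1 x = 1"
  by (simp add: one_pCons)

lemma rpoly_quat_power: "rpoly_quat (p ^ k) x = rpoly_quat p x ^ k"
  by (induction k) (simp_all add: rpoly_quat_mult)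

lemma rpoly_quat_prod_eq_0_iff:
  "finite P \<Longrightarrow> rpoly_quat (\<Prod>r\<in>P. g r) x = 0 \<longleftrightarrow> (\<exists>r\<in>P. rpoly_quat (g r) x = 0)"
  by (induction P rule: finite_induct) (simp_all add: rpoly_quat_mult)

text \<open>Since h commutes with real coefficients, the relation passes from x and y to polynomials
  in them. For nonzero h it shows that the zero set of a real polynomial is a union of similarity
  classes.\<close>

lemma rpoly_quat_intertwine:
  assumes "h * x = y * h"
  shows "h * rpoly_quat p x = rpoly_quat p y * h"
proof (induction p)
  case (pCons a p)
  have "h * (x * rpoly_quat p x) = y * (h * rpoly_quat p x)"
    by (simp add: assms flip: mult.assoc)
  with pCons show ?case
    by (simp add: algebra_simps)
qed simp

section \<open>Evaluation at quaternionic matrices\<close>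

lemma matrix_scaleR_mult:
  fixes A :: "'a::real_algebra_1 ^ 'n ^ 'm"
  shows "(r *\<^sub>R A) ** B = r *\<^sub>R (A ** B)" "A ** (r *\<^sub>R B) = r *\<^sub>R (A ** B)"
    "(r *\<^sub>R A) *v x = r *\<^sub>R (A *v x)" "A *v (r *\<^sub>R x) = r *\<^sub>R (A *v x)"
  by (simp_all add: vec_eq_iff matrix_matrix_mult_def matrix_vector_mult_def scaleR_sum_right)

lemma linear_matrix_vector_mult: "linear ((*v) (A :: 'a::real_algebra_1 ^ 'n ^ 'm))"
  by (rule linearI) (simp_all add: matrix_vector_right_distrib matrix_scaleR_mult)

lemma matrix_vector_rscale: "A *v (x *\<^sub>H c) = (A *v x) *\<^sub>H c"
  by (simp add: vec_eq_iff matrix_vector_mult_def sum_distrib_right mult.assoc)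

lemma rpoly_mat_0 [simp]: "rpoly_mat 0 A = 0"
  by (simp add: rpoly_mat_def)

lemma rpoly_mat_add: "rpoly_mat (p + q) A = rpoly_mat p A + rpoly_mat q A"
  by (simp only: rpoly_mat_def poly_sum_add)

lemma rpoly_mat_smult: "rpoly_mat (smult a p) A = a *\<^sub>R rpoly_mat p A"
  by (simp only: rpoly_mat_def poly_sum_smult)

lemma matrix_mult_sum_right:
  "(A :: 'a::semiring_1 ^ 'n ^ 'm) ** (\<Sum>i\<in>I. B i) = (\<Sum>i\<in>I. A ** B i)"
  by (induction I rule: infinite_finite_induct) (simp_all add: matrix_add_ldistrib)

lemma rpoly_mat_pCons [simp]: "rpoly_mat (pCons a p) A = a *\<^sub>R mat 1 + A ** rpoly_mat p A"
  by (simp add: rpoly_mat_def poly_sum_pCons matrix_mult_sum_right matrix_scaleR_mult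
      del: coeff_pCons_Suc degree_pCons_eq_if)

lemma rpoly_mat_1 [simp]: "rpoly_mat 1 A = mat 1"
  by (simp add: one_pCons)

lemma matrix_add_rdistrib:
  "((A :: 'a::semiring_1 ^ 'n ^ 'm) + B) ** C = A ** C + B ** C"
  by (simp add: vec_eq_iff matrix_matrix_mult_def sum.distrib distrib_right)

lemma rpoly_mat_mult: "rpoly_mat (p * q) A = rpoly_mat p A ** rpoly_mat q A"
  by (induction p)
    (simp_all add: rpoly_mat_add rpoly_mat_smult matrix_add_rdistrib matrix_scaleR_mult
      flip: matrix_mul_assoc)

lemma rpoly_mat_power: "rpoly_mat (p ^ k) A = mat_pow (rpoly_mat p A) k"
  by (induction k) (simp_all add: rpoly_mat_mult)

text \<open>Right scalars pass through A, so each application of A to x c puts one more factor a in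
  front of c.\<close>

lemma rpoly_mat_eigenvector:
  assumes "A *v x = x *\<^sub>H a"
  shows "rpoly_mat p A *v x = x *\<^sub>H rpoly_quat p a"
  by (induction p)
    (simp_all add: matrix_vector_mult_add_rdistrib matrix_scaleR_mult rscale_distribs assms
      matrix_vector_rscale flip: matrix_vector_mul_assoc)

lemma rpoly_mat_conjugate:
  assumes "V ** U = mat 1" "U ** V = mat 1"
  shows "rpoly_mat p (V ** A ** U) = V ** rpoly_mat p A ** U"
proof (induction p)
  case (pCons a p)
  have "V ** A ** U ** (V ** rpoly_mat p A ** U) = V ** (A ** ((U ** V) ** rpoly_mat p A)) ** U"
    by (simp only: matrix_mul_assoc)
  with pCons show ?case
    by (simp add: assms matrix_add_ldistrib matrix_add_rdistrib matrix_scaleR_mult matrix_mul_assoc)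
qed simp


section \<open>Irreducible real polynomials with a quaternionic root\<close>

lemma normalize_monic: "lead_coeff (p :: real poly) = 1 \<Longrightarrow> normalize p = p"
  by (simp add: normalize_poly_eq_map_poly)

lemma monic_dvd_antisym:
  fixes r s :: "real poly"
  assumes "lead_coeff r = 1" "lead_coeff s = 1" "r dvd s" "s dvd r"
  shows "r = s"
  using assms associatedI[of r s] by (simp add: normalize_monic)

text \<open>Otherwise r and p are coprime, and evaluating a Bezout identity a r + b p = 1 at q gives
  0 = 1.\<close>

lemma irreducible_dvd_of_common_root:
  assumes "irreducible r" "rpoly_quat r q = 0" "rpoly_quat p q = 0"
  shows "r dvd p"
proof (rule ccontr)
  assume "\<not> r dvd p"
  then have "coprime r p"
    using assms(1) by (simp add: irreducible_imp_prime_elem prime_elem_imp_coprime)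
  then obtain a b where "a * r + b * p = 1"
    using bezout_coefficients_fst_snd[of r p] by (metis coprime_imp_gcd_eq_1)
  then have "rpoly_quat (a * r + b * p) q = 1"
    by simp
  then show False
    using assms by (simp add: rpoly_quat_add rpoly_quat_mult)
qed

lemma irreducible_monic_eq_of_common_root:
  assumes "irreducible r" "rpoly_quat r q = 0" "lead_coeff r = 1"
    and "irreducible s" "rpoly_quat s q = 0" "lead_coeff s = 1"
  shows "r = s"
  using assms by (intro monic_dvd_antisym irreducible_dvd_of_common_root[of _ q]) simp_all

text \<open>Every quaternion x is a root of the real quadratic \<open>ch x\<close>, with
  coefficients 1, -2 Re x and |x|^2. If p and q are roots of r, then r divides \<open>ch p\<close>
  and \<open>ch q\<close>, hence their difference, which has degree at most 1. Either the quadratics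
  agree and p, q are similar, or r is linear and p = q.\<close>

lemma irreducible_root_iff_similar:
  assumes r: "irreducible r" "rpoly_quat r q = 0"
  shows "rpoly_quat r p = 0 \<longleftrightarrow> qsimilar p q"
proof
  assume "qsimilar p q"
  then obtain h where "h \<noteq> 0" "h * p = q * h"
    by (rule qsimilarE)
  then show "rpoly_quat r p = 0"
    using rpoly_quat_intertwine[of h p q r] r by simp
next
  assume p: "rpoly_quat r p = 0"
  define ch where "ch x = [:qnorm2 x, - 2 * QRe x, 1:]" for x
  have "rpoly_quat (ch x) x = 0" for x
    by (simp add: ch_def quat_eq_iff qnorm2_def power2_eq_square algebra_simps)
  then have "r dvd ch p - ch q"
    using r p by (intro dvd_diff irreducible_dvd_of_common_root[of r])
  moreover have diff: "ch p - ch q = [:qnorm2 p - qnorm2 q, 2 * QRe q - 2 * QRe p:]"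
    by (simp add: ch_def)
  ultimately have "degree r \<le> 1" if "ch p \<noteq> ch q"
    using that dvd_imp_degree_le[of r "ch p - ch q"] degree_pCons_le[of "qnorm2 p - qnorm2 q"]
    by (metis degree_pCons_0 dual_order.trans One_nat_def right_minus_eq)
  then consider "ch p = ch q" | "degree r \<le> 1"
    by blast
  then show "qsimilar p q"
  proof cases
    case 1
    then show ?thesis
      by (simp add: ch_def qsimilar_iff)
  next
    case 2
    obtain a s where as: "r = pCons a s"
      by (cases r)
    then have "degree s = 0"
      using 2 by (simp split: if_splits)
    then obtain b where ab: "r = [:a, b:]"
      using as by (metis degree_0_id)
    have "b \<noteq> 0"
    proof
      assume "b = 0"
      then have "a = 0"
        using r ab by simp
      then show False
        using r ab \<open>b = 0\<close> by simp
    qed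
    moreover have "b *\<^sub>R p = b *\<^sub>R q"
      using r(2) p ab by (simp add: add_eq_0_iff)
    ultimately show ?thesis
      by (simp add: qsimilar_iff)
  qed
qed


section \<open>The minimal polynomial and the root subspaces\<close>

text \<open>More terms than the dimension satisfy a linear relation, whose coefficients are read as
  those of a polynomial. Applied to the powers of a matrix it yields an annihilating
  polynomial.\<close>

lemma poly_relation_exists:
  fixes f :: "nat \<Rightarrow> 'a::euclidean_space"
  obtains p :: "real poly" where "p \<noteq> 0" "(\<Sum>i\<le>degree p. coeff p i *\<^sub>R f i) = 0"
proof -
  have "\<exists>c n. (\<exists>i\<le>n. c i \<noteq> 0) \<and> (\<Sum>i\<le>n. c i *\<^sub>R f i) = 0"
  proof (cases "inj f")
    case True
    define n where "n = DIM('a)"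
    have inj: "inj_on f {..n}"
      using True by (auto intro: inj_on_subset)
    then have "card (f ` {..n}) > DIM('a)"
      by (simp add: card_image n_def)
    then have "dependent (f ` {..n})"
      using independent_bound[of "f ` {..n}"] by linarith
    then obtain u where "\<exists>i\<le>n. u (f i) \<noteq> 0" "(\<Sum>v\<in>f ` {..n}. u v *\<^sub>R v) = 0"
      by (auto simp: dependent_finite)
    with inj show ?thesis
      by (intro exI[of _ "u \<circ> f"] exI[of _ n]) (auto simp: sum.reindex)
  next
    case False
    then obtain i j where ij: "f i = f j" "i \<noteq> j"
      by (auto simp: inj_def)
    define c where "c k = of_bool (k = i) - (of_bool (k = j) :: real)" for k
    have "(\<Sum>k\<le>max i j. c k *\<^sub>R f k) =
        (\<Sum>k\<le>max i j. if k = i then f k else 0) - (\<Sum>k\<le>max i j. if k = j then f k else 0)"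
      unfolding sum_subtractf[symmetric] by (intro sum.cong) (auto simp: c_def)
    then have "(\<Sum>k\<le>max i j. c k *\<^sub>R f k) = 0"
      using ij by simp
    moreover have "c i \<noteq> 0"
      using ij by (simp add: c_def)
    ultimately show ?thesis
      using max.cobounded1[of i j] by blast
  qed
  then obtain c n i where c: "i \<le> n" "c i \<noteq> 0" "(\<Sum>i\<le>n. c i *\<^sub>R f i) = 0"
    by blast
  define p where "p = (\<Sum>i\<le>n. monom (c i) i)"
  have coeff: "coeff p k = (if k \<le> n then c k else 0)" for k
    by (simp add: p_def coeff_sum)
  then have "degree p \<le> n"
    by (intro degree_le) simp
  then have "(\<Sum>i\<le>degree p. coeff p i *\<^sub>R f i) = 0"
    using c(3) by (subst poly_sum_bound[of p n]) (simp_all add: coeff)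
  moreover have "p \<noteq> 0"
    using coeff[of i] c by auto
  ultimately show ?thesis
    using that by blast
qed

section \<open>Existence and uniqueness of the minimal polynomial\<close>

lemma annihilating_poly_exists:
  obtains p where "p \<noteq> 0" "rpoly_mat p A = 0"
  using poly_relation_exists[of "mat_pow A"] unfolding rpoly_mat_def by blast

lemma monic_annihilating_poly:
  assumes "p \<noteq> 0" "rpoly_mat p A = 0"
  shows "lead_coeff (smult (inverse (lead_coeff p)) p) = 1"
    "rpoly_mat (smult (inverse (lead_coeff p)) p) A = 0"
  using assms by (simp_all add: rpoly_mat_smult)

text \<open>Both are monic of the same degree, so a nonzero difference would, after normalisation,
  be a monic annihilating polynomial of smaller degree.\<close>

lemma is_min_poly_unique:
  assumes p: "is_min_poly A p" and r: "is_min_poly A r"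
  shows "p = r"
proof (rule ccontr)
  assume "p \<noteq> r"
  have deg: "degree p = degree r"
    using p r unfolding is_min_poly_def by (meson le_antisym)
  have "rpoly_mat (p - r) A = rpoly_mat p A + rpoly_mat (smult (- 1) r) A"
    unfolding rpoly_mat_add[symmetric] by simp
  also have "\<dots> = 0"
    using p r by (simp only: rpoly_mat_smult) (simp add: is_min_poly_def)
  finally have "degree p \<le> degree (p - r)"
    using p \<open>p \<noteq> r\<close> monic_annihilating_poly[of "p - r" A]
    unfolding is_min_poly_def by (metis degree_smult_le dual_order.trans right_minus_eq)
  moreover have "coeff (p - r) (degree p) = 0"
    using p r deg by (simp add: is_min_poly_def)
  moreover have "degree (p - r) \<le> degree p"
    using deg by (simp add: degree_diff_le)
  ultimately have "p - r = 0"
    by (metis le_antisym leading_coeff_0_iff)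
  then show False
    using \<open>p \<noteq> r\<close> by simp
qed

lemma is_min_poly_min_poly: "is_min_poly A (min_poly A)"
proof -
  define P where "P d \<longleftrightarrow> (\<exists>p. lead_coeff p = 1 \<and> rpoly_mat p A = 0 \<and> degree p = d)" for d
  have "\<exists>d. P d"
    unfolding P_def
    by (rule annihilating_poly_exists[of A]) (use monic_annihilating_poly[of _ A] in blast)
  then have "P (LEAST d. P d)"
    by (rule LeastI_ex)
  then obtain p where "lead_coeff p = 1" "rpoly_mat p A = 0" "degree p = (LEAST d. P d)"
    unfolding P_def by blast
  then have "is_min_poly A p"
    unfolding is_min_poly_def using Least_le[of P] unfolding P_def by simp blast
  then show ?thesis
    unfolding min_poly_def by (rule theI) (rule is_min_poly_unique[OF _ \<open>is_min_poly A p\<close>])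
qed

section \<open>Factorisation into irreducibles and the stable kernel\<close>

lemma monic_factorization_exists:
  assumes "lead_coeff p = 1"
  obtains P m where "monic_factorization p P m"
proof
  have "p \<noteq> 0"
    using assms by auto
  have "lead_coeff r = 1 \<and> irreducible r \<and> multiplicity r p \<ge> 1" if "r \<in> prime_factors p" for r
  proof -
    have "prime r" "r dvd p"
      using that by auto
    moreover from this have "lead_coeff (normalize r) = 1"
      by (simp add: normalize_poly_eq_map_poly lead_coeff_map_poly_nz prime_imp_nonzero)
    moreover have "normalize r = r"
      using \<open>prime r\<close> by simp
    moreover have "multiplicity r p \<ge> 1"
      using \<open>prime r\<close> \<open>r dvd p\<close> \<open>p \<noteq> 0\<close> by (simp add: Suc_le_eq prime_multiplicity_gt_zero_iff)
    ultimately show ?thesis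
      by (simp add: prime_elem_imp_irreducible)
  qed
  then show "monic_factorization p (prime_factors p) (\<lambda>r. multiplicity r p)"
    unfolding monic_factorization_def
    using prod_prime_factors[OF \<open>p \<noteq> 0\<close>] normalize_monic[OF assms] by simp
qed

lemma coprime_cofactor:
  assumes "monic_factorization p P m" "r \<in> P"
  shows "coprime (r ^ k) (\<Prod>s\<in>P - {r}. s ^ m s)"
proof (rule prod_coprime_right)
  fix s assume s: "s \<in> P - {r}"
  have "\<not> r dvd s"
  proof
    assume "r dvd s"
    moreover have "\<not> is_unit r" "irreducible s"
      using assms s by (auto simp: monic_factorization_def irreducible_not_unit)
    ultimately have "s dvd r"
      using irreducibleD' by blast
    then show False
      using \<open>r dvd s\<close> assms s monic_dvd_antisym[of r s] by (auto simp: monic_factorization_def)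
  qed
  then show "coprime (r ^ k) (s ^ m s)"
    using assms
    by (auto simp: monic_factorization_def irreducible_imp_prime_elem prime_elem_imp_coprime)
qed

text \<open>With s the product of the other factors, Bezout gives a r^k + b s = 1. Multiplied by
  r^(m r), this writes r^(m r) as a multiple of r^k plus a multiple of the minimal polynomial; at A
  the first kills u and the second is zero.\<close>

lemma mat_pow_kernel_stable:
  assumes "monic_factorization (min_poly A) P m" "r \<in> P"
    and "mat_pow (rpoly_mat r A) k *v u = 0"
  shows "mat_pow (rpoly_mat r A) (m r) *v u = 0"
proof -
  define s where "s = (\<Prod>s\<in>P - {r}. s ^ m s)"
  have "gcd (r ^ k) s = 1"
    unfolding s_def using coprime_cofactor[OF assms(1,2)] by (rule coprime_imp_gcd_eq_1)
  then obtain a b where "a * r ^ k + b * s = 1"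
    using bezout_coefficients_fst_snd[of "r ^ k" s] by metis
  then have "r ^ m r = (a * r ^ k + b * s) * r ^ m r"
    by simp
  also have "\<dots> = (a * r ^ m r) * r ^ k + b * min_poly A"
    using assms(1,2) by (simp add: monic_factorization_def prod.remove[of P r] s_def algebra_simps)
  finally have eq: "r ^ m r = (a * r ^ m r) * r ^ k + b * min_poly A" .
  have "rpoly_mat (r ^ m r) A *v u =
      rpoly_mat (a * r ^ m r) A *v (rpoly_mat (r ^ k) A *v u) +
      (rpoly_mat b A ** rpoly_mat (min_poly A) A) *v u"
    by (subst eq) (simp only: rpoly_mat_add rpoly_mat_mult matrix_vector_mult_add_rdistrib
        matrix_vector_mul_assoc)
  then show ?thesis
    using is_min_poly_min_poly[of A] assms(3)
    by (simp add: rpoly_mat_power is_min_poly_def)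
qed

text \<open>From A x = x q the minimal polynomial vanishes at q, and as H has no zero divisors one
  of its factors does. That factor is determined by q, so the description in
  \<open>root_subspace\<close> has a unique value.\<close>

lemma root_subspaceE:
  assumes "right_eigenvalue A q"
  obtains r m where "irreducible r" "rpoly_quat r q = 0"
    "root_subspace q A = {u. mat_pow (rpoly_mat r A) m *v u = 0}"
    "\<And>k u. mat_pow (rpoly_mat r A) k *v u = 0 \<Longrightarrow> mat_pow (rpoly_mat r A) m *v u = 0"
proof -
  obtain P m where Pm: "monic_factorization (min_poly A) P m"
    using monic_factorization_exists is_min_poly_min_poly[of A] unfolding is_min_poly_def by metis
  obtain x where x: "x \<noteq> 0" "A *v x = x *\<^sub>H q"
    using assms unfolding right_eigenvalue_def by blast
  have "x *\<^sub>H rpoly_quat (min_poly A) q = 0"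
    using rpoly_mat_eigenvector[OF x(2), of "min_poly A"] is_min_poly_min_poly[of A]
    by (simp add: is_min_poly_def)
  then have "rpoly_quat (\<Prod>r\<in>P. r ^ m r) q = 0"
    using x(1) Pm by (simp add: rscale_eq_0_iff monic_factorization_def)
  then obtain r where r: "r \<in> P" "rpoly_quat r q = 0"
    using Pm by (auto simp: monic_factorization_def rpoly_quat_prod_eq_0_iff rpoly_quat_power)
  have "root_subspace q A = {u. mat_pow (rpoly_mat r A) (m r) *v u = 0}"
    unfolding root_subspace_def
  proof (rule the_equality)
    fix M assume "\<exists>P m r. monic_factorization (min_poly A) P m \<and> r \<in> P \<and>
      rpoly_quat r q = 0 \<and> M = {u. mat_pow (rpoly_mat r A) (m r) *v u = 0}"
    then obtain P' m' r' where *: "monic_factorization (min_poly A) P' m'" "r' \<in> P'"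
      "rpoly_quat r' q = 0" "M = {u. mat_pow (rpoly_mat r' A) (m' r') *v u = 0}"
      by blast
    then have "r' = r"
      using Pm r irreducible_monic_eq_of_common_root[of r' q r]
      by (auto simp: monic_factorization_def)
    \<comment> \<open>The exponents of the two factorisations are not compared: by stability each
      kernel contains the other.\<close>
    then show "M = {u. mat_pow (rpoly_mat r A) (m r) *v u = 0}"
      using * Pm r mat_pow_kernel_stable[of A] by blast
  qed (use Pm r in blast)
  then show ?thesis
    using that[of r "m r"] Pm r mat_pow_kernel_stable[OF Pm r(1)]
    by (auto simp: monic_factorization_def)
qed


section \<open>Eigenvectors modulo an invariant subspace\<close>

text \<open>For c with coefficients a_i this is the sum of (A^i x) a_i. Right multiplication by
  complex numbers makes H^n a complex vector space on which A is linear.\<close>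

definition cpoly_vec :: "complex poly \<Rightarrow> quat ^ 'n ^ 'n \<Rightarrow> quat ^ 'n \<Rightarrow> quat ^ 'n" where
  "cpoly_vec c A x = fold_coeffs (\<lambda>a v. x *\<^sub>H quat_of_complex a + A *v v) c 0"

lemma quat_of_complex_simps [simp]:
  "quat_of_complex 0 = 0" "quat_of_complex 1 = 1" "quat_of_complex (- a) = - quat_of_complex a"
  "quat_of_complex (of_real r) = r *\<^sub>R 1"
  "quat_of_complex (a + b) = quat_of_complex a + quat_of_complex b"
  "quat_of_complex (a * b) = quat_of_complex a * quat_of_complex b"
  by (simp_all add: quat_eq_iff)

lemma quat_of_complex_eq_0_iff [simp]: "quat_of_complex a = 0 \<longleftrightarrow> a = 0"
  by (simp add: quat_eq_iff complex_eq_iff)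

lemma cpoly_vec_0 [simp]: "cpoly_vec 0 A x = 0"
  by (simp add: cpoly_vec_def)

lemma cpoly_vec_pCons [simp]:
  "cpoly_vec (pCons a c) A x = x *\<^sub>H quat_of_complex a + A *v cpoly_vec c A x"
  by (cases "a = 0 \<and> c = 0")
    (auto simp: cpoly_vec_def fold_coeffs_pCons_not_0_0_eq fold_coeffs_pCons_coeff_not_0_eq)

lemma cpoly_vec_add: "cpoly_vec (c + d) A x = cpoly_vec c A x + cpoly_vec d A x"
  by (induction c d rule: poly_induct2)
    (simp_all add: rscale_distribs matrix_vector_right_distrib algebra_simps)

lemma cpoly_vec_smult: "cpoly_vec (smult a c) A x = cpoly_vec c A x *\<^sub>H quat_of_complex a"
proof (induction c)
  case (pCons b c)
  then show ?case
    by (simp add: rscale_distribs matrix_vector_rscale flip: quat_of_complex_simps(6))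
      (simp add: mult.commute)
qed simp

lemma cpoly_vec_linear_factor:
  "cpoly_vec ([:- a, 1:] * c) A x =
    A *v cpoly_vec c A x - cpoly_vec c A x *\<^sub>H quat_of_complex a"
  by (simp add: cpoly_vec_add cpoly_vec_smult del: smult_minus_left)

lemma cpoly_vec_of_real: "cpoly_vec (map_poly of_real p) A x = rpoly_mat p A *v x"
  by (induction p)
    (simp_all add: map_poly_pCons matrix_vector_mult_add_rdistrib matrix_scaleR_mult
      flip: matrix_vector_mul_assoc)

text \<open>Linear factors t - a are split off c until the value at x leaves W; the first value
  outside W is the required y. This happens at the latest for a nonzero constant, since x is not in
  W.\<close>

lemma eigenvector_modulo_of_cpoly:
  assumes W: "rsubspace W" and x: "x \<notin> W" and c: "c \<noteq> 0" "cpoly_vec c A x \<in> W"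
  obtains y a where "y \<notin> W" "A *v y - y *\<^sub>H quat_of_complex a \<in> W"
proof -
  have "\<exists>y a. y \<notin> W \<and> A *v y - y *\<^sub>H quat_of_complex a \<in> W"
    using c
  proof (induction "degree c" arbitrary: c rule: less_induct)
    case less
    show ?case
    proof (cases "degree c = 0")
      case True
      then obtain a where a: "c = [:a:]"
        by (metis degree_0_id)
      then have "x *\<^sub>H quat_of_complex a *\<^sub>H inverse (quat_of_complex a) \<in> W"
        using less.prems by (intro rsubspaceD(5)[OF W, of "x *\<^sub>H quat_of_complex a"]) simp
      then show ?thesis
        using x less.prems(1) a by simp
    next
      case False
      then obtain a where "poly c a = 0"
        using fundamental_theorem_of_algebra[of c] by (auto simp: constant_degree)
      then obtain s where s: "c = [:- a, 1:] * s"
        by (metis dvdE poly_eq_0_iff_dvd)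
      with less.prems have "s \<noteq> 0"
        by auto
      then have "degree s < degree c"
        unfolding s by (subst degree_mult_eq) simp_all
      show ?thesis
      proof (cases "cpoly_vec s A x \<in> W")
        case True
        then show ?thesis
          using less.hyps[OF \<open>degree s < degree c\<close> \<open>s \<noteq> 0\<close>] by blast
      next
        case False
        then show ?thesis
          using less.prems(2) unfolding s cpoly_vec_linear_factor by blast
      qed
    qed
  qed
  with that show ?thesis
    by blast
qed

text \<open>A real annihilating polynomial, read as a complex one, has value 0 at any x outside W.
  If the eigenvalue a obtained has negative imaginary part, y is replaced by y j: since a j = j
  \<open>cnj a\<close>, this conjugates the eigenvalue.\<close>

lemma eigenvector_modulo_exists:
  assumes W: "rsubspace W" "W \<noteq> UNIV"
  obtains y z where "y \<notin> W" "Im z \<ge> 0" "A *v y - y *\<^sub>H quat_of_complex z \<in> W"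
proof -
  obtain x where x: "x \<notin> W"
    using W by blast
  obtain p where "p \<noteq> 0" "rpoly_mat p A = 0"
    by (rule annihilating_poly_exists)
  then have "map_poly complex_of_real p \<noteq> 0" "cpoly_vec (map_poly of_real p) A x \<in> W"
    using rsubspaceD(2)[OF W(1)] by (simp_all add: cpoly_vec_of_real map_poly_eq_0_iff)
  then obtain y a where y: "y \<notin> W" "A *v y - y *\<^sub>H quat_of_complex a \<in> W"
    by (rule eigenvector_modulo_of_cpoly[OF W(1) x])
  show ?thesis
  proof (cases "Im a \<ge> 0")
    case False
    have "quat_j \<noteq> 0"
      by (simp add: quat_eq_iff quat_j_def)
    then have "y *\<^sub>H quat_j \<notin> W"
      using y(1) rsubspaceD(5)[OF W(1), of "y *\<^sub>H quat_j" "inverse quat_j"] by auto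
    moreover have "quat_of_complex a * quat_j = quat_j * quat_of_complex (cnj a)"
      by (simp add: quat_eq_iff quat_j_def)
    then have "A *v (y *\<^sub>H quat_j) - y *\<^sub>H quat_j *\<^sub>H quat_of_complex (cnj a) \<in> W"
      using rsubspaceD(5)[OF W(1) y(2), of quat_j] by (simp add: matrix_vector_rscale rscale_distribs)
    ultimately show ?thesis
      using that[of "y *\<^sub>H quat_j" "cnj a"] False by simp
  qed (use that y in blast)
qed


section \<open>Schur form\<close>

text \<open>The standard quaternionic inner product, right-linear in the second argument; its real
  part is the Euclidean inner product.\<close>

definition hdot :: "quat ^ 'n \<Rightarrow> quat ^ 'n \<Rightarrow> quat" where
  "hdot x y = (\<Sum>i\<in>UNIV. qcnj (x $ i) * y $ i)"

lemma qcnj_simps: "qcnj (x * y) = qcnj y * qcnj x" "qcnj (qcnj x) = x" "qcnj (x + y) = qcnj x + qcnj y"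
  "qcnj 0 = 0"
  by (simp_all add: quat_eq_iff)

lemma QRe_sum: "QRe (\<Sum>i\<in>I. f i) = (\<Sum>i\<in>I. QRe (f i))"
  by (induction I rule: infinite_finite_induct) simp_all

lemma qcnj_sum: "qcnj (\<Sum>i\<in>I. f i) = (\<Sum>i\<in>I. qcnj (f i))"
  by (induction I rule: infinite_finite_induct) (simp_all add: qcnj_simps)

lemma QRe_hdot: "QRe (hdot x y) = x \<bullet> y"
  by (simp add: hdot_def inner_vec_def inner_quat_def QRe_sum)

lemma hdot_self: "hdot x x = (x \<bullet> x) *\<^sub>R 1"
proof -
  have "qcnj a * a = (a \<bullet> a) *\<^sub>R 1" for a :: quat
    by (simp add: qcnj_mult qnorm2_def inner_quat_def power2_eq_square)
  then show ?thesis
    by (simp add: hdot_def inner_vec_def scaleR_sum_left)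
qed

lemma hdot_rscale_right: "hdot x (y *\<^sub>H c) = hdot x y * c"
  by (simp add: hdot_def sum_distrib_right mult.assoc)

lemma hdot_rscale_left: "hdot (x *\<^sub>H c) y = qcnj c * hdot x y"
  by (simp add: hdot_def sum_distrib_left mult.assoc qcnj_simps)

lemma hdot_add_right: "hdot x (y + z) = hdot x y + hdot x z"
  by (simp add: hdot_def distrib_left sum.distrib)

lemma hdot_commute: "hdot y x = qcnj (hdot x y)"
  by (simp add: hdot_def qcnj_sum qcnj_simps)

lemma rsubspace_hdot_zero: "rsubspace {x. hdot u x = 0}"
  by (rule rsubspaceI) (simp_all add: hdot_add_right hdot_rscale_right, simp add: hdot_def)

text \<open>Real orthogonality to a right subspace implies quaternionic orthogonality: test z
  against w c with c = \<open>hdot w z\<close>, where the real part is |c|^2.\<close>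

lemma hdot_eq_0_of_orthogonal:
  assumes "rsubspace W" "\<And>w. w \<in> W \<Longrightarrow> orthogonal z w" "w \<in> W"
  shows "hdot w z = 0"
proof -
  have "QRe (hdot (w *\<^sub>H hdot w z) z) = 0"
    unfolding QRe_hdot inner_commute[of _ z] using assms by (simp add: rsubspaceD flip: orthogonal_def)
  then show ?thesis
    by (simp add: hdot_rscale_left qcnj_mult qnorm2_eq_0_iff del: times_quat.simps)
qed

text \<open>The component of y orthogonal to W differs from y by an element of the invariant
  subspace W, so it is still an eigenvector modulo W for the same z. Real normalisation does not
  change z either.\<close>

lemma unit_eigenvector_modulo_exists:
  assumes W: "rsubspace W" "W \<noteq> UNIV" and inv: "\<And>w. w \<in> W \<Longrightarrow> A *v w \<in> W"
  obtains u z where "hdot u u = 1" "\<And>w. w \<in> W \<Longrightarrow> hdot w u = 0" "Im z \<ge> 0"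
    "A *v u - u *\<^sub>H quat_of_complex z \<in> W"
proof -
  obtain y z where y: "y \<notin> W" "Im z \<ge> 0" "A *v y - y *\<^sub>H quat_of_complex z \<in> W"
    by (rule eigenvector_modulo_exists[OF W])
  have span: "span W = W"
    using W(1) by (simp add: rsubspaceD(1))
  obtain w v where w: "w \<in> W" and v: "\<And>w. w \<in> W \<Longrightarrow> orthogonal v w" and ywv: "y = w + v"
    using orthogonal_subspace_decomp_exists[of W y] unfolding span by metis
  have "v \<noteq> 0"
    using w y(1) ywv by auto
  define u where "u = v /\<^sub>R norm v"
  have "v = y - w"
    by (simp add: ywv)
  then have "A *v v - v *\<^sub>H quat_of_complex z =
      (A *v y - y *\<^sub>H quat_of_complex z) - (A *v w - w *\<^sub>H quat_of_complex z)"
    by (simp add: matrix_vector_mult_diff_distrib rscale_distribs)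
  moreover have "A *v w - w *\<^sub>H quat_of_complex z \<in> W"
    using w inv W(1) by (simp add: rsubspaceD)
  ultimately have "A *v v - v *\<^sub>H quat_of_complex z \<in> W"
    using rsubspaceD(4)[OF W(1) y(3)] by simp
  then have "(A *v v - v *\<^sub>H quat_of_complex z) /\<^sub>R norm v \<in> W"
    using W(1) by (simp add: rsubspace_def subspace_scale)
  then have "A *v u - u *\<^sub>H quat_of_complex z \<in> W"
    by (simp add: u_def matrix_scaleR_mult scaleR_diff_right)
  moreover have "hdot u u = 1"
    using \<open>v \<noteq> 0\<close> by (simp add: hdot_self u_def flip: power2_norm_eq_inner)
  moreover have "hdot w u = 0" if "w \<in> W" for w
    using that v by (intro hdot_eq_0_of_orthogonal[OF W(1)]) (auto simp: u_def orthogonal_def)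
  ultimately show ?thesis
    using that y(2) by blast
qed

lemma dim_rspan_le: "finite B \<Longrightarrow> dim (rspan B) \<le> 4 * card B"
  by (rule rspan_basis_exists[of B]) (metis card_mono dim_rspan mult_le_mono2)

text \<open>The vectors are built in increasing order of the index. The span W of the earlier ones
  is A-invariant, and proper because of its dimension, so a unit eigenvector modulo W orthogonal to
  W serves as the next one.\<close>

lemma schur_basis_exists:
  fixes A :: "'n::{finite, linorder} qmat" and S :: "'n set"
  shows "\<exists>u. (\<forall>i\<in>S. \<forall>j\<in>S. hdot (u i) (u j) = of_bool (i = j)) \<and>
    (\<forall>i\<in>S. \<exists>z. Im z \<ge> 0 \<and> A *v u i - u i *\<^sub>H quat_of_complex z \<in> rspan (u ` {j\<in>S. j < i}))"
  using finite[of S]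
proof (induction S rule: finite_linorder_max_induct)
  case (insert b S)
  then obtain u where
    orth: "\<And>i j. i \<in> S \<Longrightarrow> j \<in> S \<Longrightarrow> hdot (u i) (u j) = of_bool (i = j)"
    and tri: "\<And>i. i \<in> S \<Longrightarrow>
      \<exists>z. Im z \<ge> 0 \<and> A *v u i - u i *\<^sub>H quat_of_complex z \<in> rspan (u ` {j\<in>S. j < i})"
    by blast
  define W where "W = rspan (u ` S)"
  have W: "rsubspace W"
    by (simp add: W_def rsubspace_rspan)
  have uW: "u i \<in> W" if "i \<in> S" for i
    using that by (simp add: W_def rspan_base)
  have "A *v u i \<in> W" if i: "i \<in> S" for i
  proof -
    obtain z where "A *v u i - u i *\<^sub>H quat_of_complex z \<in> rspan (u ` {j\<in>S. j < i})"
      using tri[OF i] by blast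
    then have "A *v u i - u i *\<^sub>H quat_of_complex z \<in> W"
      unfolding W_def using rspan_mono[of "u ` {j\<in>S. j < i}" "u ` S"] by blast
    then show ?thesis
      using rsubspaceD(3,5)[OF W] uW[OF i] by (metis diff_add_cancel)
  qed
  \<comment> \<open>Invariance on the generators suffices, as the preimage of W under A is a right
    subspace.\<close>
  then have "W \<subseteq> {x. A *v x \<in> W}"
    unfolding W_def
    by (intro rspan_minimal)
      (auto intro!: rsubspaceI rsubspaceD[OF rsubspace_rspan]
        simp: matrix_vector_right_distrib matrix_vector_rscale)
  moreover have "b \<notin> S"
    using insert.hyps(2) by blast
  have "card S < CARD('n)"
    using \<open>b \<notin> S\<close> by (intro psubset_card_mono) auto
  then have "dim W < DIM((quat, 'n) vec)"
    using dim_rspan_le[of "u ` S"] card_image_le[of S u] unfolding W_def by simp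
  then have "W \<noteq> UNIV"
    by auto
  ultimately obtain v z where v: "hdot v v = 1" "\<And>w. w \<in> W \<Longrightarrow> hdot w v = 0" "Im z \<ge> 0"
    "A *v v - v *\<^sub>H quat_of_complex z \<in> W"
    using unit_eigenvector_modulo_exists[OF W] by blast
  have "hdot v w = 0" if "w \<in> W" for w
    using v(2)[OF that] hdot_commute[of v w] by (simp add: qcnj_simps)
  then have "hdot ((u(b := v)) i) ((u(b := v)) j) = of_bool (i = j)"
    if "i \<in> insert b S" "j \<in> insert b S" for i j
    using that orth v uW \<open>b \<notin> S\<close> by auto
  moreover have "\<exists>z. Im z \<ge> 0 \<and> A *v (u(b := v)) i - (u(b := v)) i *\<^sub>H quat_of_complex z \<in>
      rspan (u(b := v) ` {j\<in>insert b S. j < i})" if "i \<in> insert b S" for i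
  proof (cases "i = b")
    case True
    have "u(b := v) ` {j\<in>insert b S. j < b} = u ` S"
      using insert.hyps(2) by (intro image_cong) auto
    then show ?thesis
      using v(3,4) True by (auto simp: W_def)
  next
    case False
    then have i: "i \<in> S" "i < b"
      using that insert.hyps(2) by auto
    then have "u(b := v) ` {j\<in>insert b S. j < i} = u ` {j\<in>S. j < i}"
      by (intro image_cong) auto
    then show ?thesis
      using tri[OF i(1)] False by simp
  qed
  ultimately show ?case
    by blast
qed simp

text \<open>A left inverse makes U injective, hence surjective as a real-linear endomorphism in
  finite dimension.\<close>

lemma matrix_left_inverse_right_inverse:
  fixes U V :: "quat ^ 'n ^ 'n"
  assumes "V ** U = mat 1"
  shows "U ** V = mat 1"
proof -
  have VU: "V *v (U *v x) = x" for x
    by (simp add: matrix_vector_mul_assoc assms)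
  then have "surj ((*v) U)"
    using linear_injective_imp_surjective[OF linear_matrix_vector_mult[of U]] by (metis injI)
  then have "U *v (V *v y) = y" for y
    using VU by (metis surjD)
  then show ?thesis
    by (simp add: matrix_eq matrix_vector_mul_assoc)
qed

lemma schur_form_exists:
  fixes A :: "'n::{finite, linorder} qmat"
  obtains U T where "schur_form A U T"
proof -
  obtain u :: "'n \<Rightarrow> (quat, 'n) vec" where "\<forall>i j. hdot (u i) (u j) = of_bool (i = j)"
    and "\<forall>i. \<exists>z. Im z \<ge> 0 \<and> A *v u i - u i *\<^sub>H quat_of_complex z \<in> rspan (u ` {j. j < i})"
    using schur_basis_exists[of UNIV A] by simp blast
  then have orth: "\<And>i j. hdot (u i) (u j) = of_bool (i = j)"
    and tri: "\<And>i. \<exists>z. Im z \<ge> 0 \<and> A *v u i - u i *\<^sub>H quat_of_complex z \<in> rspan (u ` {j. j < i})"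
    by blast+
  define U :: "'n qmat" where "U = (\<chi> i j. u j $ i)"
  define T where "T = adjoint_mat U ** A ** U"
  have "adjoint_mat U ** U = mat 1"
    using orth by (simp add: vec_eq_iff matrix_matrix_mult_def adjoint_mat_def U_def hdot_def mat_def)
  then have "unitary U"
    by (simp add: unitary_def matrix_left_inverse_right_inverse)
  have T: "T $ i $ j = hdot (u i) (A *v u j)" for i j
    unfolding T_def matrix_mul_assoc[symmetric]
    by (simp add: matrix_matrix_mult_def matrix_vector_mult_def adjoint_mat_def U_def hdot_def)
  \<comment> \<open>Modulo the span of the u k with k < j, A maps u j to u j z. For i \<ge> j the
    vector u i is orthogonal to that span, so only u j z contributes to the entry.\<close>
  have "\<exists>z. Im z \<ge> 0 \<and> (\<forall>i\<ge>j. T $ i $ j = (if i = j then quat_of_complex z else 0))" for j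
  proof -
    obtain z w where z: "Im z \<ge> 0" and w: "w \<in> rspan (u ` {k. k < j})"
      "w = A *v u j - u j *\<^sub>H quat_of_complex z"
      using tri[of j] by blast
    have "hdot (u i) w = 0" if "i \<ge> j" for i
    proof -
      have "rspan (u ` {k. k < j}) \<subseteq> {x. hdot (u i) x = 0}"
        using that orth by (intro rspan_minimal rsubspace_hdot_zero) auto
      then show ?thesis
        using w(1) by blast
    qed
    moreover have "A *v u j = w + u j *\<^sub>H quat_of_complex z"
      by (simp add: w(2))
    ultimately show ?thesis
      using z by (intro exI[of _ z]) (simp add: T hdot_add_right hdot_rscale_right orth)
  qed
  then have "upper_triangular T" "\<forall>i. \<exists>z. T $ i $ i = quat_of_complex z \<and> Im z \<ge> 0"
    unfolding upper_triangular_def by (metis less_le not_less, metis order_refl)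
  then show ?thesis
    using that \<open>unitary U\<close> T_def unfolding schur_form_def by blast
qed


section \<open>Triangular matrices\<close>

lemma upper_triangular_mult:
  fixes S T :: "'n::{finite, linorder} qmat"
  assumes "upper_triangular S" "upper_triangular T"
  shows "upper_triangular (S ** T)" "(S ** T) $ i $ i = S $ i $ i * T $ i $ i"
proof -
  \<comment> \<open>If k < i the first factor vanishes, if k > j the second; with j \<le> i this
    leaves only k = i = j.\<close>
  have 0: "S $ i $ k * T $ k $ j = 0" if "j \<le> i" "k \<noteq> i \<or> j \<noteq> i" for i j k
    using assms that unfolding upper_triangular_def
    by (metis le_less_linear less_le_trans mult_zero_left mult_zero_right not_less_iff_gr_or_eq)
  show "upper_triangular (S ** T)"
    unfolding upper_triangular_def
  proof (intro allI impI)
    fix i j :: 'n assume "j < i"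
    then show "(S ** T) $ i $ j = 0"
      unfolding matrix_matrix_mult_def vec_lambda_beta by (intro sum.neutral ballI 0) auto
  qed
  have "(\<Sum>k\<in>UNIV. S $ i $ k * T $ k $ i) = (\<Sum>k\<in>{i}. S $ i $ k * T $ k $ i)"
    using 0[of i i] by (intro sum.mono_neutral_right) auto
  then show "(S ** T) $ i $ i = S $ i $ i * T $ i $ i"
    by (simp add: matrix_matrix_mult_def)
qed

lemma upper_triangular_rpoly_mat:
  assumes "upper_triangular T"
  shows "upper_triangular (rpoly_mat p T) \<and> (\<forall>i. rpoly_mat p T $ i $ i = rpoly_quat p (T $ i $ i))"
proof (induction p)
  case 0
  then show ?case
    by (simp add: upper_triangular_def)
next
  case (pCons a p)
  then have *: "upper_triangular (T ** rpoly_mat p T)"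
    "(T ** rpoly_mat p T) $ i $ i = T $ i $ i * rpoly_quat p (T $ i $ i)" for i
    using assms by (simp_all add: upper_triangular_mult)
  show ?case
    using *(1) by (simp add: *(2)) (auto simp: upper_triangular_def mat_def)
qed

lemma upper_triangular_mat_pow:
  assumes "upper_triangular T"
  shows "upper_triangular (mat_pow T k) \<and> (\<forall>i. mat_pow T k $ i $ i = (T $ i $ i) ^ k)"
proof (induction k)
  case 0
  then show ?case
    by (simp add: upper_triangular_def mat_def)
next
  case (Suc k)
  then show ?case
    using assms by (simp add: upper_triangular_mult)
qed

section \<open>Stable kernels of triangular matrices\<close>

lemma mat_pow_commute: "mat_pow A k ** A = A ** mat_pow A k"
  by (induction k) (simp_all flip: matrix_mul_assoc)

lemma rsubspace_kernel: "rsubspace {u. A *v u = 0}"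
  by (rule rsubspaceI) (simp_all add: matrix_vector_right_distrib matrix_vector_rscale)

lemma linear_image_eq:
  fixes f :: "'a::euclidean_space \<Rightarrow> 'a"
  assumes "linear f" "subspace S" "f ` S \<subseteq> S" "\<And>x. x \<in> S \<Longrightarrow> f x = 0 \<Longrightarrow> x = 0"
  shows "f ` S = S"
proof (rule subspace_dim_equal)
  have "span S = S"
    using assms(2) by simp
  then have "inj_on f (span S)"
    using assms(4) linear_inj_on_iff_eq_0[OF assms(1,2)] by (simp only:) blast
  then show "dim S \<le> dim (f ` S)"
    by (simp add: dim_image_eq[OF assms(1)])
qed (use assms in \<open>simp_all add: linear_subspace_image\<close>)

text \<open>
  The coordinate subspaces of an initial segment of indices form an invariant flag. Passing from
  \<open>S\<close> to \<open>insert b S\<close>, the kernel grows by one dimension exactly if \<open>N $ b $ b = 0\<close>: in this case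
  \<open>N e\<^sub>b\<close> lies in the smaller coordinate subspace, on the stable image of which \<open>N\<close> is
  surjective, so that \<open>e\<^sub>b\<close> can be corrected to a vector of the kernel.
\<close>

lemma dim_stable_kernel_flag:
  fixes N :: "'n::{finite, linorder} qmat"
  assumes N: "upper_triangular N"
    and stable: "\<And>u. mat_pow N (Suc m) *v u = 0 \<Longrightarrow> mat_pow N m *v u = 0"
    and S: "\<And>i j. i \<in> S \<Longrightarrow> j < i \<Longrightarrow> j \<in> S"
  shows "dim ({u. mat_pow N m *v u = 0} \<inter> {x. \<forall>i. i \<notin> S \<longrightarrow> x $ i = 0}) =
    4 * card {i \<in> S. N $ i $ i = 0}"
  using finite[of S] S
proof (induction S rule: finite_linorder_max_induct)
  case empty
  have "{u. mat_pow N m *v u = 0} \<inter> {x. \<forall>i. i \<notin> {} \<longrightarrow> x $ i = 0} = {0}"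
    by (auto simp: vec_eq_iff)
  then show ?case
    by (simp add: dim_eq_0)
next
  case (insert b S)
  define K where "K = {u. mat_pow N m *v u = 0}"
  define F where "F S = {x :: (quat, 'n) vec. \<forall>i. i \<notin> S \<longrightarrow> x $ i = 0}" for S
  have down: "j \<in> S" if "i \<in> insert b S" "j < i" for i j
    using insert.prems[OF that] insert.hyps(2) that by auto
  have "b \<notin> S"
    using insert.hyps(2) by blast
  have rF: "rsubspace (F S)" for S
    by (rule rsubspaceI) (simp_all add: F_def)
  have rK: "rsubspace K"
    unfolding K_def by (rule rsubspace_kernel)
  have rKF: "rsubspace (K \<inter> F S)" for S
    using rK rF[of S] by (auto simp: rsubspace_def subspace_inter)
  have IH: "dim (K \<inter> F S) = 4 * card {i \<in> S. N $ i $ i = 0}"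
    unfolding K_def F_def using insert.IH down by blast
  have sub: "F S \<subseteq> F (insert b S)"
    by (auto simp: F_def)
  have inF: "x \<in> F S" if "x \<in> F (insert b S)" "x $ b = 0" for x
    using that by (auto simp: F_def)
  have "dim (K \<inter> F (insert b S)) = 4 * card {i \<in> insert b S. N $ i $ i = 0}"
  proof (cases "N $ b $ b = 0")
    case False
    \<comment> \<open>Row b of N^m meets the support of x only at b, with the nonzero entry N_bb^m,
      so the kernel does not grow.\<close>
    have "x $ b = 0" if x: "x \<in> K" "x \<in> F (insert b S)" for x
    proof -
      have "mat_pow N m $ b $ i * x $ i = 0" if "i \<noteq> b" for i
      proof (cases "i < b")
        case True
        then show ?thesis
          using upper_triangular_mat_pow[OF N, of m] by (simp add: upper_triangular_def)
      next
        case False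
        then have "i \<notin> insert b S"
          using that insert.hyps(2) by auto
        then show ?thesis
          using x(2) by (simp add: F_def)
      qed
      then have "(mat_pow N m *v x) $ b = (\<Sum>i\<in>{b}. mat_pow N m $ b $ i * x $ i)"
        unfolding matrix_vector_mult_def vec_lambda_beta by (intro sum.mono_neutral_right) auto
      then show ?thesis
        using x(1) False upper_triangular_mat_pow[OF N, of m] by (simp add: K_def)
    qed
    then have "K \<inter> F (insert b S) = K \<inter> F S"
      using sub inF by blast
    moreover have "{i \<in> insert b S. N $ i $ i = 0} = {i \<in> S. N $ i $ i = 0}"
      using False by auto
    ultimately show ?thesis
      using IH by simp
  next
    case True
    define f where "f = (*v) (mat_pow N m)"
    have f: "linear f"
      unfolding f_def by (rule linear_matrix_vector_mult)
    have comm: "N *v f x = f (N *v x)" for x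
      by (simp add: f_def matrix_vector_mul_assoc mat_pow_commute)
    have N_F: "N *v x \<in> F S" if "x \<in> F S" for x
    proof -
      have "N $ i $ j * x $ j = 0" if "i \<notin> S" for i j
      proof (cases "j \<in> S")
        case True
        then have "j < i"
          using that down[of j i] by (metis insertCI not_less_iff_gr_or_eq)
        then show ?thesis
          using N by (simp add: upper_triangular_def)
      qed (use \<open>x \<in> F S\<close> in \<open>simp add: F_def\<close>)
      then show ?thesis
        unfolding F_def matrix_vector_mult_def
        by (intro CollectI allI impI) (simp only: vec_lambda_beta, intro sum.neutral ballI)
    qed
    have image: "(*v) N ` f ` F S = f ` F S"
    proof (rule linear_image_eq[OF linear_matrix_vector_mult])
      show "subspace (f ` F S)"
        using rF[of S] by (simp add: linear_subspace_image f rsubspaceD)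
      show "(*v) N ` f ` F S \<subseteq> f ` F S"
        using N_F by (auto simp: comm)
    next
      \<comment> \<open>With y = N^m x, N y = 0 says that N^(m+1) x = 0; stability then gives y = 0,
        so N is injective on this image.\<close>
      fix y assume "y \<in> f ` F S" "N *v y = 0"
      then show "y = 0"
        using stable by (auto simp: f_def matrix_vector_mul_assoc)
    qed
    define e where "e = (axis b 1 :: (quat, 'n) vec)"
    have "N *v e = column b N"
      by (simp add: e_def vec_eq_iff matrix_vector_mult_def axis_def column_def if_distrib cong: if_cong)
    then have "N *v e \<in> F S"
    proof -
      have "N $ i $ b = 0" if "i \<notin> S" for i
        using that True N down[of b i] unfolding upper_triangular_def
        by (metis insertI1 not_less_iff_gr_or_eq)
      then show ?thesis
        using \<open>N *v e = column b N\<close> by (simp add: F_def column_def)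
    qed
    then have "f (N *v e) \<in> (*v) N ` f ` F S"
      using image by blast
    then obtain y where y: "y \<in> F S" "N *v f e = N *v f y"
      by (auto simp: comm)
    \<comment> \<open>N maps N^m e and N^m y to the same vector, so N^(m+1) kills k and stability
      puts k into \<open>K\<close>. Since y is supported in S, the coordinate of k at b is
      1.\<close>
    define k where "k = e - y"
    have "mat_pow N (Suc m) *v k = 0"
      using y(2) by (simp add: k_def f_def matrix_vector_mult_diff_distrib flip: matrix_vector_mul_assoc)
    then have "k \<in> K"
      unfolding K_def by (simp only: mem_Collect_eq stable)
    have "e \<in> F (insert b S)"
      by (simp add: e_def F_def axis_def)
    then have "k \<in> F (insert b S)"
      unfolding k_def using y(1) sub rsubspaceD(4)[OF rF] by blast
    have "k $ b = 1"
      using y(1) \<open>b \<notin> S\<close> by (simp add: k_def e_def F_def)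
    have "K \<inter> F (insert b S) = radjoin k (K \<inter> F S)"
    proof (intro equalityI subsetI)
      fix x assume x: "x \<in> K \<inter> F (insert b S)"
      \<comment> \<open>Subtracting this multiple of k clears coordinate b, which leaves an element
        of the smaller kernel.\<close>
      define z where "z = x - k *\<^sub>H x $ b"
      have "z \<in> K \<inter> F (insert b S)"
        unfolding z_def using x \<open>k \<in> K\<close> \<open>k \<in> F (insert b S)\<close> rsubspaceD(4,5)[OF rKF] by blast
      moreover have "z $ b = 0"
        using \<open>k $ b = 1\<close> by (simp add: z_def)
      ultimately have "z + k *\<^sub>H x $ b \<in> radjoin k (K \<inter> F S)"
        using inF by (intro radjoinI) blast
      then show "x \<in> radjoin k (K \<inter> F S)"
        by (simp add: z_def)
    next
      fix x assume "x \<in> radjoin k (K \<inter> F S)"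
      then obtain z c where "z \<in> K \<inter> F S" "x = z + k *\<^sub>H c"
        by (rule radjoinE)
      then show "x \<in> K \<inter> F (insert b S)"
        using \<open>k \<in> K\<close> \<open>k \<in> F (insert b S)\<close> sub rsubspaceD(3,5)[OF rKF, of _ "insert b S"] by blast
    qed
    moreover have "k \<notin> K \<inter> F S"
      using \<open>k $ b = 1\<close> \<open>b \<notin> S\<close> by (auto simp: F_def)
    moreover have "{i \<in> insert b S. N $ i $ i = 0} = insert b {i \<in> S. N $ i $ i = 0}"
      using True by auto
    ultimately show ?thesis
      using IH \<open>b \<notin> S\<close> by (simp add: dim_radjoin[OF rKF])
  qed
  then show ?case
    by (simp add: K_def F_def)
qed

lemma dim_stable_kernel:
  assumes "upper_triangular N"
    and "\<And>u. mat_pow N (Suc m) *v u = 0 \<Longrightarrow> mat_pow N m *v u = 0"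
  shows "dim {u. mat_pow N m *v u = 0} = 4 * card {i. N $ i $ i = 0}"
  using dim_stable_kernel_flag[OF assms, of UNIV] by simp


section \<open>Comparison of the multiplicities\<close>

lemma rsubspace_root_subspace:
  assumes "right_eigenvalue A q"
  shows "rsubspace (root_subspace q A)"
  by (rule root_subspaceE[OF assms]) (simp add: rsubspace_kernel)

text \<open>The inverse V of U carries the root subspace isomorphically onto the stable kernel of
  the triangular matrix r(T). Its diagonal entries r(T_ii) vanish exactly where T_ii is similar to
  q.\<close>

lemma dim_root_subspace:
  assumes q: "right_eigenvalue A q" and schur: "schur_form A U T"
  shows "dim (root_subspace q A) = 4 * card {i. T $ i $ i = quat_of_complex (std_rep q)}"
proof -
  obtain r m where r: "irreducible r" "rpoly_quat r q = 0"
    and M: "root_subspace q A = {u. mat_pow (rpoly_mat r A) m *v u = 0}"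
    and stable: "\<And>k u. mat_pow (rpoly_mat r A) k *v u = 0 \<Longrightarrow> mat_pow (rpoly_mat r A) m *v u = 0"
    using root_subspaceE[OF q] by blast
  define V where "V = adjoint_mat U"
  have UV: "U ** V = mat 1" and VU: "V ** U = mat 1" and T: "T = V ** A ** U"
    and upper: "upper_triangular T"
    using schur unfolding schur_form_def unitary_def V_def by blast+
  have cancel: "V *v (U *v u) = u" "U *v (V *v u) = u" for u
    by (simp_all add: matrix_vector_mul_assoc UV VU)
  have "mat_pow (rpoly_mat r T) k = V ** mat_pow (rpoly_mat r A) k ** U" for k
    using rpoly_mat_conjugate[OF VU UV, of "r ^ k" A] by (simp only: T rpoly_mat_power)
  then have conj: "mat_pow (rpoly_mat r T) k *v u = V *v (mat_pow (rpoly_mat r A) k *v (U *v u))" for k u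
    by (simp only: matrix_vector_mul_assoc matrix_mul_assoc)
  have V0: "V *v u = 0 \<longleftrightarrow> u = 0" for u
    using cancel(2)[of u] by auto
  have ker: "mat_pow (rpoly_mat r T) k *v u = 0 \<longleftrightarrow> mat_pow (rpoly_mat r A) k *v (U *v u) = 0" for k u
    by (simp only: conj V0)
  have diag: "rpoly_mat r T $ i $ i = 0 \<longleftrightarrow> T $ i $ i = quat_of_complex (std_rep q)" for i
  proof -
    obtain z where z: "T $ i $ i = quat_of_complex z" "Im z \<ge> 0"
      using schur unfolding schur_form_def by blast
    have "rpoly_mat r T $ i $ i = rpoly_quat r (T $ i $ i)"
      using upper_triangular_rpoly_mat[OF upper] by blast
    then show ?thesis
      using irreducible_root_iff_similar[OF r, of "T $ i $ i"] quat_of_complex_similar_iff[OF z(2), of q]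
      by (simp only: z(1))
  qed
  have "{u. mat_pow (rpoly_mat r T) m *v u = 0} = (*v) V ` root_subspace q A"
  proof (intro equalityI subsetI)
    fix u assume "u \<in> {u. mat_pow (rpoly_mat r T) m *v u = 0}"
    then have "U *v u \<in> root_subspace q A"
      by (simp add: ker M)
    then show "u \<in> (*v) V ` root_subspace q A"
      using cancel(1)[of u] by (metis imageI)
  qed (auto simp: ker M cancel)
  moreover have "inj_on ((*v) V) (span (root_subspace q A))"
    by (rule inj_on_inverseI[of _ "(*v) U"]) (rule cancel)
  ultimately have "dim (root_subspace q A) = dim {u. mat_pow (rpoly_mat r T) m *v u = 0}"
    by (simp add: dim_image_eq[OF linear_matrix_vector_mult])
  also have "\<dots> = 4 * card {i. rpoly_mat r T $ i $ i = 0}"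
    using upper_triangular_rpoly_mat[OF upper] stable
    by (intro dim_stable_kernel) (simp_all only: ker)
  finally show ?thesis
    by (simp only: diag)
qed

text \<open>The count equals the dimension of the root subspace for every Schur form, so it does not
  depend on the form and the description in \<open>alg_mult\<close> is well defined.\<close>

lemma alg_mult_eq:
  assumes "right_eigenvalue A q"
  shows "alg_mult q A = q_alg_mult q A"
proof -
  have eq: "card {i. T $ i $ i = quat_of_complex (std_rep q)} = q_alg_mult q A"
    if "schur_form A U T" for U T
    using dim_root_subspace[OF assms that] rdim_eq[OF rsubspace_root_subspace[OF assms]]
    by (simp add: q_alg_mult_def)
  obtain U T where "schur_form A U T"
    by (rule schur_form_exists)
  then show ?thesis
    unfolding alg_mult_def using eq by (intro the_equality) (metis, metis)
qed

section \<open>Eigenvectors in the root subspace and geometric multiplicity\<close>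

lemma right_eigenvector_root_subspace_iff:
  assumes q: "right_eigenvalue A q"
  shows "x \<in> root_subspace q A \<and> right_eigenvector A x \<longleftrightarrow>
    x \<noteq> 0 \<and> (\<exists>p\<in>sim_class q. x \<in> eigvecs0 p A)"
proof -
  obtain r m where r: "irreducible r" "rpoly_quat r q = 0"
    and M: "root_subspace q A = {u. mat_pow (rpoly_mat r A) m *v u = 0}"
    and stable: "\<And>k u. mat_pow (rpoly_mat r A) k *v u = 0 \<Longrightarrow> mat_pow (rpoly_mat r A) m *v u = 0"
    using root_subspaceE[OF q] by blast
  have "x \<in> root_subspace q A \<longleftrightarrow> qsimilar p q" if x: "A *v x = x *\<^sub>H p" "x \<noteq> 0" for p
  proof -
    have pow: "mat_pow (rpoly_mat r A) k *v x = x *\<^sub>H rpoly_quat r p ^ k" for k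
      using rpoly_mat_eigenvector[OF x(1), of "r ^ k"] by (simp only: rpoly_mat_power rpoly_quat_power)
    have "x \<in> root_subspace q A \<longleftrightarrow> rpoly_quat r p = 0"
    proof
      assume "x \<in> root_subspace q A"
      then show "rpoly_quat r p = 0"
        using x(2) by (simp add: M pow rscale_eq_0_iff)
    next
      assume "rpoly_quat r p = 0"
      \<comment> \<open>The vanishing of r(p) gives the first power only; stability moves the
        conclusion to exponent m.\<close>
      then have "mat_pow (rpoly_mat r A) 1 *v x = 0"
        by (simp only: pow) simp
      then show "x \<in> root_subspace q A"
        using stable by (simp only: M mem_Collect_eq)
    qed
    then show ?thesis
      by (simp only: irreducible_root_iff_similar[OF r])
  qed
  then show ?thesis
    unfolding right_eigenvector_def sim_class_def eigvecs0_def by blast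
qed

text \<open>If A x = x p and c is nonzero, then x c is an eigenvector for the similar quaternion
  c^(-1) p c. Hence plain finite sums over the whole class are already closed under right
  scalars.\<close>

lemma class_eigenspace_eq:
  "class_eigenspace q A = rspan {x. x \<noteq> 0 \<and> (\<exists>p\<in>sim_class q. x \<in> eigvecs0 p A)}"
    (is "_ = rspan ?E")
proof
  have "sum_list xs \<in> rspan ?E" if "\<forall>x\<in>set xs. \<exists>p\<in>sim_class q. x \<in> eigvecs0 p A" for xs
    using that
  proof (induction xs)
    case (Cons x xs)
    then have "x \<in> rspan ?E"
      using rsubspaceD(2)[OF rsubspace_rspan] by (cases "x = 0") (auto intro: rspan_base)
    with Cons show ?case
      by (simp add: rsubspaceD(3)[OF rsubspace_rspan])
  qed (simp add: rsubspaceD(2)[OF rsubspace_rspan])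
  then show "class_eigenspace q A \<subseteq> rspan ?E"
    by (auto simp: class_eigenspace_def)
  have smult: "\<exists>p\<in>sim_class q. x *\<^sub>H c \<in> eigvecs0 p A"
    if x: "p \<in> sim_class q" "x \<in> eigvecs0 p A" for x p c
  proof (cases "c = 0")
    case True
    then show ?thesis
      using x by (auto simp: eigvecs0_def)
  next
    case False
    define p' where "p' = inverse c * p * c"
    have "c * p' = p * c"
      using False by (simp add: p'_def flip: mult.assoc)
    then have "qsimilar p' p"
      using False by (intro qsimilarI)
    then have "p' \<in> sim_class q"
      using x(1) by (simp add: sim_class_def qsimilar_iff)
    moreover have "x *\<^sub>H c \<in> eigvecs0 p' A"
      using x(2) \<open>c * p' = p * c\<close> by (simp add: eigvecs0_def matrix_vector_rscale)
    ultimately show ?thesis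
      by blast
  qed
  have "rsubspace (class_eigenspace q A)"
  proof (rule rsubspaceI)
    show "0 \<in> class_eigenspace q A"
      unfolding class_eigenspace_def by (simp, intro exI[of _ "[]"]) simp
  next
    fix x y assume "x \<in> class_eigenspace q A" "y \<in> class_eigenspace q A"
    then obtain xs ys where "x = sum_list xs" "\<forall>x\<in>set xs. \<exists>p\<in>sim_class q. x \<in> eigvecs0 p A"
      "y = sum_list ys" "\<forall>x\<in>set ys. \<exists>p\<in>sim_class q. x \<in> eigvecs0 p A"
      unfolding class_eigenspace_def by blast
    then show "x + y \<in> class_eigenspace q A"
      unfolding class_eigenspace_def by (simp, intro exI[of _ "xs @ ys"]) auto
  next
    fix x c assume "x \<in> class_eigenspace q A"
    then obtain xs where xs: "x = sum_list xs" "\<forall>x\<in>set xs. \<exists>p\<in>sim_class q. x \<in> eigvecs0 p A"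
      unfolding class_eigenspace_def by blast
    have "sum_list xs *\<^sub>H c = sum_list (map (\<lambda>x. x *\<^sub>H c) xs)"
      by (induction xs) (simp_all add: rscale_distribs)
    moreover have "\<forall>x\<in>set (map (\<lambda>x. x *\<^sub>H c) xs). \<exists>p\<in>sim_class q. x \<in> eigvecs0 p A"
      using xs(2) smult by fastforce
    ultimately show "x *\<^sub>H c \<in> class_eigenspace q A"
      unfolding class_eigenspace_def xs(1) by blast
  qed
  moreover have "?E \<subseteq> class_eigenspace q A"
  proof
    fix x assume "x \<in> ?E"
    then show "x \<in> class_eigenspace q A"
      unfolding class_eigenspace_def by (simp, intro exI[of _ "[x]"]) simp
  qed
  ultimately show "rspan ?E \<subseteq> class_eigenspace q A"
    by (rule rspan_minimal)
qed

text \<open>A basis of the [q]-eigenspace can be chosen among the eigenvectors in the root subspace,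
  and no independent set of them exceeds the dimension of their span.\<close>

lemma geom_mult_eq:
  assumes "right_eigenvalue A q"
  shows "geom_mult q A = q_geom_mult q A"
proof -
  define E where "E = {x \<in> root_subspace q A. right_eigenvector A x}"
  have V: "class_eigenspace q A = rspan E"
    by (simp only: class_eigenspace_eq E_def right_eigenvector_root_subspace_iff[OF assms])
  obtain B where B: "finite B" "B \<subseteq> E" "rindependent B" "rspan B = rspan E"
    by (rule rspan_basis_exists)
  define C where "C = {card B | B. finite B \<and> B \<subseteq> root_subspace q A \<and>
    (\<forall>x\<in>B. right_eigenvector A x) \<and> rindependent B}"
  have rdim: "4 * geom_mult q A = dim (rspan E)"
    unfolding geom_mult_def V by (rule rdim_eq[OF rsubspace_rspan])
  have le: "n \<le> geom_mult q A" if n: "n \<in> C" for n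
  proof -
    obtain D where D: "n = card D" "finite D" "D \<subseteq> E" "rindependent D"
      using n unfolding C_def E_def by blast
    then have "D \<subseteq> rspan E"
      using rspan_base by blast
    then show ?thesis
      using card_rindependent_le[OF D(2,4) _ rsubspace_rspan, of E] rdim D(1) by simp
  qed
  have "card B = geom_mult q A"
    using dim_rspan[OF B(1,3)] B(4) rdim by simp
  moreover have "card B \<in> C"
    using B unfolding C_def E_def by blast
  \<comment> \<open>The bound also makes C finite, as required for \<open>Max\<close>.\<close>
  moreover have "finite C"
    using le by (intro finite_subset[of C "{..geom_mult q A}"]) auto
  ultimately have "Max C = geom_mult q A"
    using le by (intro Max_eqI) auto
  then show ?thesis
    by (simp add: q_geom_mult_def C_def)
qed

theorem corollary3p2:
  fixes A :: "'n::{finite, linorder} qmat" and q :: quat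
  assumes "right_eigenvalue A q"
  shows "alg_mult q A = q_alg_mult q A \<and> geom_mult q A = q_geom_mult q A"
  using alg_mult_eq[OF assms] geom_mult_eq[OF assms] by blast

end
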